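(* Let $\mathcal{M}^p=(X,\mathcal{I})$ be a $p$-matchoid of rank $k$ and let $f:2^X\to\mathbb{R}_{\ge0}$ be a non-negative submodular function. Suppose there exists an offline algorithm for the problem with approximation factor $\bar\gamma_{\mathrm{off}}$. Then for any $\varepsilon>0$, the randomized multi-pass streaming local-search algorithm (MultipassRandomizedLocalSearch, run with $d=O(p/\varepsilon)$ passes, $\varepsilon'=\varepsilon/p$, buffer size $m=4dk/\varepsilon'^2$, $\beta_1=1$, $\beta_i=\frac{\gamma_{i-1}-1-p}{\gamma_{i-1}-1+p}$ with $\gamma_1=4p$, $\gamma_i=\frac{4p\gamma_{i-1}(\gamma_{i-1}-1)}{(\gamma_{i-1}-1+p)^2}$, and $\alpha$ obtained by guessing $f(\mathit{OPT})$ as described) returns a solution $\bar S\in\mathcal{I}$ such that \[ f(\mathit{OPT})\le\bigl(p+1+\bar\gamma_{\mathrm{off}}+O(\varepsilon)\bigr)\,\mathbb{E}[f(\bar S)], \] storing a total of $O\bigl(\frac{p^3k\log_2k}{\varepsilon^3}\bigr)$ elements and using $O(p/\varepsilon)$ passes.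
   Context: $X$ is a finite ground set and $f:2^X\to\mathbb{R}_{\ge0}$ is submodular (not necessarily monotone). For $e\in X$, $A\subseteq X$ write $f(e\mid A)=f(A\cup\{e\})-f(A)$. A $p$-matchoid on $X$ is a collection of matroids $\mathcal{M}_\ell=(X_\ell,\mathcal{I}_\ell)$, $X_\ell\subseteq X$, with every element of $X$ in at most $p$ of the sets $X_\ell$; $S$ is feasible ($S\in\mathcal{I}$) iff $S\cap X_\ell\in\mathcal{I}_\ell$ for all $\ell$. The rank $k$ is the maximum size of a feasible set; $\mathit{OPT}$ is a feasible set maximizing $f$. Elements of $X$ arrive one at a time in a stream; each pass receives all of $X$. An offline algorithm Offline with approximation factor $\bar\gamma_{\mathrm{off}}$ takes a set $B\subseteq X$ and returns a feasible $S'\subseteq B$ with $\max_{T\subseteq B,T\in\mathcal{I}}f(T)\le\bar\gamma_{\mathrm{off}}\mathbb{E}[f(S')]$. Incremental values: for a total order $\prec$ on $X$, $\nu(e,T)=f(e\mid\{t\in T:t\prec e\})$; here $\prec$ is the order in which elements are inserted into the current solution $S$, elements of the initial solution coming first in their previous order. Exchange$(x,S)$: start with $C_x=\emptyset$; for each $\mathcal{M}_\ell$ with $x\in X_\ell$, let $S_\ell=S\cap X_\ell$; if $S_\ell\cup\{x\}\notin\mathcal{I}_\ell$, let $T_\ell=\{y\in S_\ell:(S_\ell\setminus\{y\})\cup\{x\}\in\mathcal{I}_\ell\}$ and add to $C_x$ an element of $T_\ell$ minimizing $\nu(\cdot,S)$. Return $C_x$. RandomizedLocalSearch$(S_{\mathrm{init}},\alpha,\beta,m)$: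 $S\leftarrow S_{\mathrm{init}}$, $B\leftarrow\emptyset$. For each arriving $x$: with $C_x=$ Exchange$(x,S)$, if $f(x\mid S)\ge\alpha+(1+\beta)\sum_{e\in C_x}\nu(e,S)$ add $x$ to $B$. Whenever $|B|=m$: choose $x$ uniformly at random from $B$, compute $C_x=$ Exchange$(x,S)$, remove $x$ from $B$, set $S\leftarrow(S\setminus C_x)\cup\{x\}$; then for each $x'\in B$ recompute $C_{x'}=$ Exchange$(x',S)$ and remove $x'$ from $B$ if $f(x'\mid S)<\alpha+(1+\beta)\sum_{e\in C_{x'}}\nu(e,S)$. At the end of the stream set $S'=$ Offline$(B)$ and return $(S,S')$. MultipassRandomizedLocalSearch$(\alpha,\beta_1,\dots,\beta_d,m)$: $S_0=S'_0=\emptyset$; for $i=1,\dots,d$, let $(\tilde S,S')$ be the output of RandomizedLocalSearch$(S_{i-1},\alpha,\beta_i,m)$ on a new pass, set $S_i=\tilde S$ and $S'_i$ the one of $S'_{i-1},S'$ with larger $f$-value. Return $\bar S$, the one of $S_d,S'_d$ with larger $f$-value. Guessing $f(\mathit{OPT})$: one extra pass computes $\tau=\max_{e\in X}f(\{e\})$; then for every $\lambda\in\{2^j: j\in\mathbb{Z},\ \tau\le2^j\le k\tau\}$ a copy of the algorithm is run in parallel with $\alpha=\varepsilon'\lambda/(2k)$, and the best output among all copies is returned.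
   Formalization: Proved for k ≥ 2 and ε ≤ p; the constant in O(ε) may depend on a bound K for γ_off/p (a uniform one is impossible); elements x with {x} infeasible, for which Exchange is undefined, are skipped in every pass, including when computing τ. *)

theory Defs
  imports "HOL-Probability.Probability"
begin

section \<open>Constraints and objective\<close>

definition is_matroid :: "'a set \<times> 'a set set \<Rightarrow> bool" where
  "is_matroid M \<longleftrightarrow> (case M of (E, I) \<Rightarrow>
     finite E \<and> I \<subseteq> Pow E \<and> {} \<in> I \<and> (\<forall>A\<in>I. \<forall>B. B \<subseteq> A \<longrightarrow> B \<in> I) \<and>
     (\<forall>A\<in>I. \<forall>B\<in>I. card A < card B \<longrightarrow> (\<exists>x\<in>B - A. insert x A \<in> I)))"

text \<open>A collection of matroids is a list of pairs (ground set, independent sets).\<close>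

definition p_matchoid :: "nat \<Rightarrow> 'a set \<Rightarrow> ('a set \<times> 'a set set) list \<Rightarrow> bool" where
  "p_matchoid p X Ms \<longleftrightarrow>
     finite X \<and> (\<forall>M\<in>set Ms. is_matroid M \<and> fst M \<subseteq> X) \<and>
     (\<forall>x\<in>X. length (filter (\<lambda>M. x \<in> fst M) Ms) \<le> p)"

definition satisfies :: "('a set \<times> 'a set set) list \<Rightarrow> 'a set \<Rightarrow> bool" where
  "satisfies Ms S \<longleftrightarrow> (\<forall>M\<in>set Ms. S \<inter> fst M \<in> snd M)"

definition feasible_sets :: "'a set \<Rightarrow> ('a set \<times> 'a set set) list \<Rightarrow> 'a set set" where
  "feasible_sets X Ms = {S. S \<subseteq> X \<and> satisfies Ms S}"

definition matchoid_rank :: "'a set \<Rightarrow> ('a set \<times> 'a set set) list \<Rightarrow> nat" where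
  "matchoid_rank X Ms = Max (card ` feasible_sets X Ms)"

definition nonneg_submodular :: "'a set \<Rightarrow> ('a set \<Rightarrow> real) \<Rightarrow> bool" where
  "nonneg_submodular X f \<longleftrightarrow>
     (\<forall>A\<subseteq>X. 0 \<le> f A) \<and> (\<forall>A\<subseteq>X. \<forall>B\<subseteq>X. f (A \<union> B) + f (A \<inter> B) \<le> f A + f B)"

definition offline_approx ::
  "'a set \<Rightarrow> ('a set \<times> 'a set set) list \<Rightarrow> ('a set \<Rightarrow> real) \<Rightarrow> real \<Rightarrow> ('a set \<Rightarrow> 'a set pmf) \<Rightarrow> bool" where
  "offline_approx X Ms f \<gamma> off \<longleftrightarrow>
     (\<forall>B\<subseteq>X. set_pmf (off B) \<subseteq> {S \<in> feasible_sets X Ms. S \<subseteq> B} \<and>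
        (\<forall>T\<in>feasible_sets X Ms. T \<subseteq> B \<longrightarrow> f T \<le> \<gamma> * measure_pmf.expectation (off B) f))"

definition marginal :: "('a set \<Rightarrow> real) \<Rightarrow> 'a \<Rightarrow> 'a set \<Rightarrow> real" where
  "marginal f e A = f (insert e A) - f A"

section \<open>Randomized local search\<close>

text \<open>The current solution is a list without repetitions, in order of insertion, so the order
  defining the incremental values is the position in the list.\<close>

definition incr :: "('a set \<Rightarrow> real) \<Rightarrow> 'a list \<Rightarrow> 'a \<Rightarrow> real" where
  "incr f S e = marginal f e (set (takeWhile (\<lambda>t. t \<noteq> e) S))"

text \<open>Ties are broken by the choice operator inside \<open>arg_min_on\<close>. The set of candidates is
  nonempty if \<open>S\<close> is feasible and \<open>{x}\<close> is independent in every matroid.\<close>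

definition exchange ::
  "('a set \<Rightarrow> real) \<Rightarrow> ('a set \<times> 'a set set) list \<Rightarrow> 'a \<Rightarrow> 'a list \<Rightarrow> 'a set" where
  "exchange f Ms x S =
     (\<lambda>(E, I). arg_min_on (incr f S) {y \<in> set S \<inter> E. ((set S \<inter> E) - {y}) \<union> {x} \<in> I}) `
       {(E, I) \<in> set Ms. x \<in> E \<and> (set S \<inter> E) \<union> {x} \<notin> I}"

definition accepts ::
  "('a set \<Rightarrow> real) \<Rightarrow> ('a set \<times> 'a set set) list \<Rightarrow> real \<Rightarrow> real \<Rightarrow> 'a list \<Rightarrow> 'a \<Rightarrow> bool" where
  "accepts f Ms \<alpha> \<beta> S x \<longleftrightarrow>
     marginal f x (set S) \<ge> \<alpha> + (1 + \<beta>) * (\<Sum>e\<in>exchange f Ms x S. incr f S e)"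

text \<open>The last component of every state and result below is the peak number of elements held in
  memory so far. While \<open>x\<close> is processed these are the solution, the buffer and \<open>x\<close>.\<close>

definition rls_step ::
  "('a set \<Rightarrow> real) \<Rightarrow> ('a set \<times> 'a set set) list \<Rightarrow> real \<Rightarrow> real \<Rightarrow> nat \<Rightarrow> 'a \<Rightarrow>
   'a list \<times> 'a set \<times> nat \<Rightarrow> ('a list \<times> 'a set \<times> nat) pmf" where
  "rls_step f Ms \<alpha> \<beta> m x = (\<lambda>(S, B, w).
     let B1 = (if accepts f Ms \<alpha> \<beta> S x then insert x B else B);
         w1 = max w (length S + card (insert x B))
     in if card B1 = m then
          do {
            y \<leftarrow> pmf_of_set B1;
            let S1 = filter (\<lambda>e. e \<notin> exchange f Ms y S) S @ [y];
            return_pmf (S1, {x' \<in> B1 - {y}. accepts f Ms \<alpha> \<beta> S1 x'}, w1)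
          }
        else return_pmf (S, B1, w1))"

primrec rls_loop ::
  "('a set \<Rightarrow> real) \<Rightarrow> ('a set \<times> 'a set set) list \<Rightarrow> real \<Rightarrow> real \<Rightarrow> nat \<Rightarrow> 'a list \<Rightarrow>
   'a list \<times> 'a set \<times> nat \<Rightarrow> ('a list \<times> 'a set \<times> nat) pmf" where
  "rls_loop f Ms \<alpha> \<beta> m [] st = return_pmf st"
| "rls_loop f Ms \<alpha> \<beta> m (x # xs) st =
     do { st' \<leftarrow> rls_step f Ms \<alpha> \<beta> m x st; rls_loop f Ms \<alpha> \<beta> m xs st' }"

definition randomized_local_search ::
  "('a set \<Rightarrow> real) \<Rightarrow> ('a set \<times> 'a set set) list \<Rightarrow> ('a set \<Rightarrow> 'a set pmf) \<Rightarrow>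
   'a list \<Rightarrow> real \<Rightarrow> real \<Rightarrow> nat \<Rightarrow> 'a list \<Rightarrow> ('a list \<times> 'a set \<times> nat) pmf" where
  "randomized_local_search f Ms off S_init \<alpha> \<beta> m stream =
     do {
       (S, B, w) \<leftarrow> rls_loop f Ms \<alpha> \<beta> m stream (S_init, {}, 0);
       S' \<leftarrow> off B;
       return_pmf (S, S', max w (length S + card B + card S'))
     }"

definition better :: "('a set \<Rightarrow> real) \<Rightarrow> 'a set \<Rightarrow> 'a set \<Rightarrow> 'a set" where
  "better f A B = (if f B \<le> f A then A else B)"

text \<open>In \<open>multipass\<close>, pass \<open>i\<close> reads the stream \<open>\<sigma> i\<close>. The best offline solution of the earlier
  passes is kept in memory throughout a pass and hence added to the storage of that pass.\<close>

primrec multipass ::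
  "('a set \<Rightarrow> real) \<Rightarrow> ('a set \<times> 'a set set) list \<Rightarrow> ('a set \<Rightarrow> 'a set pmf) \<Rightarrow>
   real \<Rightarrow> (nat \<Rightarrow> real) \<Rightarrow> nat \<Rightarrow> (nat \<Rightarrow> 'a list) \<Rightarrow> nat \<Rightarrow> ('a list \<times> 'a set \<times> nat) pmf" where
  "multipass f Ms off \<alpha> \<beta> m \<sigma> 0 = return_pmf ([], {}, 0)"
| "multipass f Ms off \<alpha> \<beta> m \<sigma> (Suc i) =
     do {
       (S, S', w) \<leftarrow> multipass f Ms off \<alpha> \<beta> m \<sigma> i;
       (S1, S1', w1) \<leftarrow> randomized_local_search f Ms off S \<alpha> (\<beta> (Suc i)) m (\<sigma> (Suc i));
       return_pmf (S1, better f S' S1', max w (w1 + card S'))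
     }"

definition multipass_randomized_local_search ::
  "('a set \<Rightarrow> real) \<Rightarrow> ('a set \<times> 'a set set) list \<Rightarrow> ('a set \<Rightarrow> 'a set pmf) \<Rightarrow>
   real \<Rightarrow> (nat \<Rightarrow> real) \<Rightarrow> nat \<Rightarrow> (nat \<Rightarrow> 'a list) \<Rightarrow> nat \<Rightarrow> ('a set \<times> nat) pmf" where
  "multipass_randomized_local_search f Ms off \<alpha> \<beta> m \<sigma> d =
     map_pmf (\<lambda>(S, S', w). (better f (set S) S', w)) (multipass f Ms off \<alpha> \<beta> m \<sigma> d)"

section \<open>Parameters and guessing of the optimal value\<close>

text \<open>Both sequences are indexed from 1; the value of \<open>gamma_seq\<close> at 0 is a dummy.\<close>

fun gamma_seq :: "nat \<Rightarrow> nat \<Rightarrow> real" where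
  "gamma_seq p 0 = 0"
| "gamma_seq p (Suc 0) = 4 * real p"
| "gamma_seq p (Suc (Suc i)) =
     4 * real p * gamma_seq p (Suc i) * (gamma_seq p (Suc i) - 1)
       / (gamma_seq p (Suc i) - 1 + real p)\<^sup>2"

definition beta_seq :: "nat \<Rightarrow> nat \<Rightarrow> real" where
  "beta_seq p i = (if i = 1 then 1
     else (gamma_seq p (i - 1) - 1 - real p) / (gamma_seq p (i - 1) - 1 + real p))"

definition guesses :: "real \<Rightarrow> nat \<Rightarrow> real set" where
  "guesses \<tau> k = {l. \<exists>j::int. l = 2 powi j \<and> \<tau> \<le> l \<and> l \<le> real k * \<tau>}"

text \<open>Independent copies of a randomized algorithm, one for each parameter in the list. The sum
  of the peaks bounds the storage of the copies at any common time. If there is no copy (only possible for \<open>\<tau> = 0\<close> when \<open>k \<ge> 2\<close>), the output is empty.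
  Otherwise the empty set does not improve on any of the copies, all of which already compare
  against it.\<close>

primrec best_of_copies ::
  "('a set \<Rightarrow> real) \<Rightarrow> (real \<Rightarrow> ('a set \<times> nat) pmf) \<Rightarrow> real list \<Rightarrow> ('a set \<times> nat) pmf" where
  "best_of_copies f run [] = return_pmf ({}, 0)"
| "best_of_copies f run (l # ls) =
     do {
       (A, w) \<leftarrow> run l;
       (A', w') \<leftarrow> best_of_copies f run ls;
       return_pmf (better f A A', w + w')
     }"

text \<open>Pass 0 computes \<open>\<tau>\<close>; passes 1 to \<open>d\<close> are shared by all copies. Elements \<open>x\<close> for which \<open>{x}\<close>
  is infeasible, where \<open>exchange\<close> has no candidate to remove, are skipped in every pass.\<close>

definition streaming_algorithm ::
  "('a set \<Rightarrow> real) \<Rightarrow> ('a set \<times> 'a set set) list \<Rightarrow> ('a set \<Rightarrow> 'a set pmf) \<Rightarrow>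
   nat \<Rightarrow> nat \<Rightarrow> real \<Rightarrow> nat \<Rightarrow> (nat \<Rightarrow> 'a list) \<Rightarrow> ('a set \<times> nat) pmf" where
  "streaming_algorithm f Ms off p k \<epsilon> d \<sigma> =
     (let \<sigma>' = (\<lambda>i. filter (\<lambda>x. satisfies Ms {x}) (\<sigma> i));
          \<tau> = Max ((\<lambda>e. f {e}) ` set (\<sigma>' 0));
          \<epsilon>' = \<epsilon> / real p;
          m = nat \<lceil>4 * real d * real k / \<epsilon>'\<^sup>2\<rceil>
      in best_of_copies f
           (\<lambda>l. multipass_randomized_local_search f Ms off
                  (\<epsilon>' * l / (2 * real k)) (beta_seq p) m \<sigma>' d)
           (sorted_list_of_set (guesses \<tau> k)))"

end

theory Submission
  imports Defs
begin

text \<open>Fix a pass with initial solution \<open>S\<^sub>0\<close>, and let \<open>A\<close> be the set of elements that were in the solution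
  at some time. Each swap increases the value of the solution by at least \<open>\<alpha>\<close> plus \<open>\<beta>\<close> times the total
  incremental value of the removed elements. In each matroid, the span of the kept elements of
  incremental value above a threshold, together with those removed on account of another matroid,
  only grows; comparing level sets bounds the charges of the rejected elements of a feasible set \<open>T\<close>.
  This gives
  \<open>f (T \<union> A) + (p/\<beta> + p - 1) f S\<^sub>0 \<le> f (T \<inter> B) + p (1 + \<beta>)\<^sup>2 / \<beta> f S + |T| \<alpha>\<close>
  with \<open>B\<close> the final buffer, which the offline algorithm takes care of. The choice of \<open>\<beta>\<^sub>i\<close> makes these
  inequalities combine over the passes to the factor \<open>\<gamma>\<^sub>i\<close>, and \<open>\<gamma>\<^sub>i - 1 - p\<close> is at most \<open>7 p / i\<close>.
  As every insertion gains \<open>\<alpha>\<close> and picks each element with probability at most \<open>1 / m\<close>, no element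
  belongs to \<open>A\<close> with probability more than \<open>f OPT / (\<alpha> m)\<close>, hence \<open>f (T \<union> A)\<close> is in expectation not much
  smaller than \<open>f T\<close>.\<close>

section \<open>Matroid spans\<close>

text \<open>As f need not be monotone, f (T \<union> A) can be far below f T for a given A. This is
  why insertions are drawn at random from a buffer: no element may be likely to enter A. A has to
  contain all past solutions, so that a marginal bounded at the time of rejection stays bounded with
  respect to A. The obstacle in the charging is that an element removed on account of one matroid
  lies in up to p - 1 others. Charging its last value there costs at most (p - 1) R, where R is the
  total incremental value removed, and \<beta> R is at most the gain of the pass. To combine passes,
  the bound for the earlier ones, with factor \<gamma>, is multiplied by \<theta> = (p/\<beta> + p -
  1) / \<gamma> and added to the bound for the next pass. The values of the intermediate solution
  cancel, and the new factor is p (1 + \<beta>)^2 / (\<beta> (1 + \<theta>)). Its minimum over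
  \<beta> > 0 is attained at the prescribed \<beta> and is the next \<gamma>. In the first pass only
  p (1 + \<beta>)^2 / \<beta> is to be minimised, hence \<beta> = 1 and 4 p. The recursion has the
  fixed point p + 1.\<close>

locale matroid =
  fixes E :: "'a set" and I :: "'a set set"
  assumes matroid: "is_matroid (E, I)"
begin

lemma finite_ground: "finite E"
  and indep_subset_ground: "J \<in> I \<Longrightarrow> J \<subseteq> E"
  and empty_indep: "{} \<in> I"
  and indep_subset: "J \<in> I \<Longrightarrow> J' \<subseteq> J \<Longrightarrow> J' \<in> I"
  and augment: "J \<in> I \<Longrightarrow> J' \<in> I \<Longrightarrow> card J < card J' \<Longrightarrow> \<exists>x\<in>J' - J. insert x J \<in> I"
  using matroid unfolding is_matroid_def by auto

lemma finite_indep: "J \<in> I \<Longrightarrow> finite J"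
  using indep_subset_ground finite_ground finite_subset by blast

definition basis :: "'a set \<Rightarrow> 'a set \<Rightarrow> bool" where
  "basis U J \<longleftrightarrow> J \<in> I \<and> J \<subseteq> U \<and> (\<forall>x\<in>U - J. insert x J \<notin> I)"

text \<open>Closure without a rank function: some basis of U stays maximal after adding e. Elements
  outside E act as loops and lie in every span, so \<open>span\<close> applies to arbitrary
  sets.\<close>

definition span :: "'a set \<Rightarrow> 'a set" where
  "span U = {e. \<exists>J. basis U J \<and> basis (insert e U) J}"

lemma indep_extend:
  assumes "J \<in> I" "J \<subseteq> U"
  obtains J' where "basis U J'" "J \<subseteq> J'"
proof -
  define P where "P K \<longleftrightarrow> K \<in> I \<and> J \<subseteq> K \<and> K \<subseteq> U" for K
  have "P J" using assms by (simp add: P_def)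
  moreover have "\<forall>K. P K \<longrightarrow> card K < Suc (card E)"
    unfolding P_def using indep_subset_ground finite_ground card_mono by (metis less_Suc_eq_le)
  ultimately obtain K where K: "P K" "\<And>K'. P K' \<Longrightarrow> card K' \<le> card K"
    using ex_has_greatest_nat[of P J card "Suc (card E)"] by blast
  have "insert x K \<notin> I" if "x \<in> U - K" for x
  proof
    assume "insert x K \<in> I"
    then have "P (insert x K)" using K(1) that by (auto simp: P_def)
    then have "card (insert x K) \<le> card K" by (rule K(2))
    then show False using that K(1) finite_indep by (auto simp: P_def)
  qed
  then show thesis using that[of K] K(1) by (auto simp: P_def basis_def)
qed

lemma basis_exists: obtains J where "basis U J"
  using indep_extend[OF empty_indep empty_subsetI] by blast

lemma indep_card_le_basis:
  assumes "basis U J" "D \<in> I" "D \<subseteq> U" shows "card D \<le> card J"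
proof (rule ccontr)
  assume "\<not> card D \<le> card J"
  then obtain x where "x \<in> D - J" "insert x J \<in> I"
    using augment[of J D] assms by (auto simp: basis_def)
  then show False using assms by (auto simp: basis_def)
qed

lemma basis_card_eq: "basis U J \<Longrightarrow> basis U J' \<Longrightarrow> card J = card J'"
  using indep_card_le_basis by (meson basis_def order_antisym)

text \<open>If \<open>insert e J\<close> were independent for some basis J of U, it would be larger
  than the basis K shared by U and \<open>insert e U\<close>. Hence the existential in
  \<open>span\<close> may be read as a universal quantifier.\<close>

lemma basis_insert_span:
  assumes "e \<in> span U" "basis U J" shows "basis (insert e U) J"
proof -
  obtain K where K: "basis U K" "basis (insert e U) K" using assms(1) by (auto simp: span_def)
  have "insert e J \<notin> I" if "e \<notin> J"
  proof
    assume *: "insert e J \<in> I"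
    have "insert e J \<subseteq> insert e U" using assms(2) by (auto simp: basis_def)
    then have "card (insert e J) \<le> card K" using indep_card_le_basis[OF K(2) *] by simp
    moreover have "card (insert e J) = Suc (card J)"
      using that assms(2) finite_indep by (simp add: basis_def)
    ultimately show False using basis_card_eq[OF K(1) assms(2)] by simp
  qed
  then show ?thesis using assms(2) by (auto simp: basis_def)
qed

lemma basis_Un_span:
  assumes "W \<subseteq> span U" "basis U J" shows "basis (U \<union> W) J"
  using basis_insert_span[OF _ assms(2)] assms by (fastforce simp: basis_def)

lemma subset_span: "U \<subseteq> span U"
proof
  fix e assume "e \<in> U"
  obtain J where "basis U J" by (rule basis_exists)
  then show "e \<in> span U" using \<open>e \<in> U\<close> by (auto simp: span_def insert_absorb)
qed

text \<open>A basis J' of U' stays one for U' \<union> U. If \<open>insert e J'\<close> were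
  independent, it would be larger than a basis K of U' \<union> U extending a basis J of U, so some
  x of it could be added to K. By maximality x = e, and then \<open>insert e J\<close> is
  independent, against e \<in> span U.\<close>

lemma span_trans:
  assumes "U \<subseteq> span U'" "e \<in> span U" shows "e \<in> span U'"
proof -
  obtain J' where J': "basis U' J'" by (rule basis_exists)
  obtain J where J: "basis U J" by (rule basis_exists)
  have Je: "basis (insert e U) J" by (rule basis_insert_span[OF assms(2) J])
  have b: "basis (U' \<union> U) J'" by (rule basis_Un_span[OF assms(1) J'])
  obtain K where K: "basis (U' \<union> U) K" "J \<subseteq> K"
    by (rule indep_extend[of J "U' \<union> U"]) (use J in \<open>auto simp: basis_def\<close>)
  have "insert e J' \<notin> I" if "e \<notin> J'"
  proof
    assume *: "insert e J' \<in> I"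
    have "card K < card (insert e J')"
      using basis_card_eq[OF K(1) b] that b finite_indep by (simp add: basis_def)
    then obtain x where x: "x \<in> insert e J' - K" "insert x K \<in> I"
      using augment[OF _ *, of K] K by (auto simp: basis_def)
    have "x \<notin> U' \<union> U" using x K by (auto simp: basis_def)
    then have "x = e" using x b by (auto simp: basis_def)
    then have "insert e J \<in> I" "e \<notin> J" using x K(2) indep_subset[of "insert x K" "insert e J"] by auto
    then show False using Je by (auto simp: basis_def)
  qed
  then have "basis (insert e U') J'" using J' by (auto simp: basis_def)
  then show ?thesis using J' by (auto simp: span_def)
qed

lemma span_mono: "U \<subseteq> U' \<Longrightarrow> span U \<subseteq> span U'"
  using span_trans subset_span by blast

text \<open>A basis of U is still maximal in U \<union> D, so D is at most as large. This turns span
  inclusions of level sets into inequalities between cardinalities.\<close>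

lemma indep_card_le_spanning:
  assumes "D \<in> I" "D \<subseteq> span U" "finite U" shows "card D \<le> card U"
proof -
  obtain J where J: "basis U J" by (rule basis_exists)
  have "card D \<le> card J"
    using indep_card_le_basis[OF basis_Un_span[OF assms(2) J]] assms(1) by blast
  also have "card J \<le> card U" using J assms(3) by (auto simp: basis_def intro: card_mono)
  finally show ?thesis .
qed

lemma indep_dependent_span: "J \<in> I \<Longrightarrow> insert e J \<notin> I \<Longrightarrow> e \<in> span J"
  by (auto simp: span_def basis_def intro!: exI[of _ J])

context
  fixes S T x
  assumes S: "S \<in> I" and dep: "insert x S \<notin> I"
    and T: "T = {y \<in> S. insert x (S - {y}) \<in> I}"
begin

text \<open>\<open>insert x T\<close> is the fundamental circuit of x in S. If it were independent,
  a basis J of \<open>insert x S\<close> containing it would have the size of S and omit exactly one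
  t \<in> S. Then J = \<open>insert x (S - {t})\<close> shows t \<in> T \<subseteq> J, a
  contradiction.\<close>

lemma circuit_dependent: "insert x T \<notin> I"
proof
  assume *: "insert x T \<in> I"
  have x: "x \<notin> S" using S dep by (auto simp: insert_absorb)
  have bS: "basis (insert x S) S" using S dep by (auto simp: basis_def)
  obtain J where J: "basis (insert x S) J" "insert x T \<subseteq> J"
    by (rule indep_extend[OF *, of "insert x S"]) (use T in auto)
  have "\<not> S \<subseteq> J" using J dep by (metis basis_def insert_absorb insert_subset subset_insertI2 subset_antisym insert_mono)
  then obtain t where t: "t \<in> S" "t \<notin> J" by auto
  have "J \<subseteq> insert x (S - {t})" using J t by (auto simp: basis_def)
  moreover have "card J = card (insert x (S - {t}))"
    using basis_card_eq[OF bS J(1)] t x finite_indep[OF S] card_Suc_Diff1 by fastforce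
  ultimately have "J = insert x (S - {t})" using finite_indep[OF S] by (simp add: card_subset_eq)
  then have "t \<in> T" using J(1) t T by (auto simp: basis_def)
  then show False using J(2) t by auto
qed

lemma circuit_spans_new: "x \<in> span T"
  by (rule indep_dependent_span[OF indep_subset[OF S] circuit_dependent]) (use T in auto)

text \<open>Used when y is removed in favour of x: whatever y helped to span is still spanned by x
  and the rest of the circuit.\<close>

lemma circuit_spans_old:
  assumes "y \<in> T" shows "y \<in> span (insert x (T - {y}))"
proof (rule indep_dependent_span)
  have "insert x (S - {y}) \<in> I" using assms T by auto
  then show "insert x (T - {y}) \<in> I" by (rule indep_subset) (use T in auto)
  show "insert y (insert x (T - {y})) \<notin> I"
    using circuit_dependent assms by (simp add: insert_commute insert_absorb)
qed

lemma circuit_nonempty: "{x} \<in> I \<Longrightarrow> T \<noteq> {}"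
  using circuit_dependent by auto

end

end

section \<open>Incremental values of submodular functions\<close>

lemma marginal_mem: "e \<in> A \<Longrightarrow> marginal f e A = 0"
  by (simp add: marginal_def insert_absorb)

locale objective =
  fixes X :: "'a set" and f :: "'a set \<Rightarrow> real"
  assumes finite_X: "finite X" and nonneg_submod: "nonneg_submodular X f"
begin

lemma nonneg: "A \<subseteq> X \<Longrightarrow> 0 \<le> f A"
  and submod: "A \<subseteq> X \<Longrightarrow> B \<subseteq> X \<Longrightarrow> f (A \<union> B) + f (A \<inter> B) \<le> f A + f B"
  using nonneg_submod by (auto simp: nonneg_submodular_def)

text \<open>The last assumption excludes elements of B - A: there the marginal at B is 0, which can
  exceed a negative marginal at A. For e \<in> A both sides are 0.\<close>

lemma marginal_antimono:
  assumes "A \<subseteq> B" "B \<subseteq> X" "e \<in> X" "e \<notin> B - A"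
  shows "marginal f e B \<le> marginal f e A"
proof (cases "e \<in> A")
  case False
  then have "insert e A \<union> B = insert e B" "insert e A \<inter> B = A" using assms by auto
  moreover have "insert e A \<subseteq> X" using assms by auto
  ultimately show ?thesis using submod[of "insert e A" B] assms(2) by (simp add: marginal_def)
qed (use assms in \<open>auto simp: marginal_mem\<close>)

lemma sum_marginal_ge:
  assumes "A \<subseteq> X" "D \<subseteq> X"
  shows "f (A \<union> D) - f A \<le> (\<Sum>e\<in>D. marginal f e A)"
proof -
  have "finite D" using assms finite_X finite_subset by blast
  then show ?thesis using assms(2)
  proof (induction D rule: finite_induct)
    case (insert e D)
    have "marginal f e (A \<union> D) \<le> marginal f e A"
      using insert assms by (intro marginal_antimono) auto
    then show ?case using insert by (auto simp: marginal_def)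
  qed simp
qed

lemma subadditive: "A \<subseteq> X \<Longrightarrow> B \<subseteq> X \<Longrightarrow> f (A \<union> B) \<le> f A + f B"
  using submod[of A B] nonneg[of "A \<inter> B"] by (simp add: le_infI1)

lemma le_sum_singletons:
  assumes "A \<noteq> {}" "A \<subseteq> X" shows "f A \<le> (\<Sum>e\<in>A. f {e})"
proof -
  have "finite A" using assms finite_X finite_subset by blast
  then show ?thesis using assms
  proof (induction A rule: finite_ne_induct)
    case (insert e A)
    then show ?case using subadditive[of "{e}" A] by auto
  qed simp
qed

lemma incr_snoc:
  "incr f (S @ [y]) e = (if e \<in> set S then incr f S e
     else if e = y then marginal f y (set S) else marginal f e (insert y (set S)))"
  by (auto simp: incr_def takeWhile_append)

lemma sum_incr: "distinct S \<Longrightarrow> (\<Sum>e\<in>set S. incr f S e) = f (set S) - f {}"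
proof (induction S rule: rev_induct)
  case (snoc y S)
  then have "(\<Sum>e\<in>set (S @ [y]). incr f (S @ [y]) e)
     = incr f (S @ [y]) y + (\<Sum>e\<in>set S. incr f (S @ [y]) e)" by simp
  also have "(\<Sum>e\<in>set S. incr f (S @ [y]) e) = (\<Sum>e\<in>set S. incr f S e)"
    by (intro sum.cong) (auto simp: incr_snoc)
  finally show ?case using snoc by (auto simp: incr_snoc marginal_def)
qed simp

text \<open>Deleting elements only shortens the prefix in front of e. Hence the values of kept
  elements never decrease under swaps.\<close>

lemma incr_filter_ge:
  assumes "set S \<subseteq> X" "e \<in> set S" "P e"
  shows "incr f S e \<le> incr f (filter P S) e"
proof -
  have "set (takeWhile (\<lambda>t. t \<noteq> e) (filter P S)) \<subseteq> set (takeWhile (\<lambda>t. t \<noteq> e) S)"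
    using assms(3) by (induction S) auto
  then show ?thesis
    unfolding incr_def using assms
    by (intro marginal_antimono) (auto dest: set_takeWhileD)
qed

text \<open>The values telescope to f S - f {}, and the kept elements account for at most f (S - C)
  - f {}, because their values can only grow when C is deleted.\<close>

lemma remove_loss:
  assumes "distinct S" "set S \<subseteq> X" "C \<subseteq> set S"
  shows "f (set S) - f (set S - C) \<le> (\<Sum>e\<in>C. incr f S e)"
proof -
  let ?S = "filter (\<lambda>e. e \<notin> C) S"
  have *: "set ?S = set S - C" by auto
  have "(\<Sum>e\<in>set ?S. incr f S e) \<le> (\<Sum>e\<in>set ?S. incr f ?S e)"
    by (intro sum_mono incr_filter_ge) (use assms in auto)
  also have "\<dots> = f (set S - C) - f {}" using sum_incr[of ?S] assms * by simp
  finally have "(\<Sum>e\<in>set S - C. incr f S e) \<le> f (set S - C) - f {}" using * by simp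
  moreover have "(\<Sum>e\<in>set S. incr f S e) = (\<Sum>e\<in>set S - C. incr f S e) + (\<Sum>e\<in>C. incr f S e)"
    using assms by (intro sum.subset_diff) auto
  ultimately show ?thesis using sum_incr[OF assms(1)] by linarith
qed

text \<open>Submodularity for S and \<open>insert y (S - C)\<close>: the union is S with y, the
  intersection S - C.\<close>

lemma swap_gain:
  assumes "distinct S" "set S \<subseteq> X" "C \<subseteq> set S" "y \<in> X" "y \<notin> set S"
  shows "marginal f y (set S) - (\<Sum>e\<in>C. incr f S e) \<le> f (insert y (set S - C)) - f (set S)"
proof -
  have "set S \<union> insert y (set S - C) = insert y (set S)" "set S \<inter> insert y (set S - C) = set S - C"
    using assms by auto
  then have "f (insert y (set S)) + f (set S - C) \<le> f (set S) + f (insert y (set S - C))"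
    using submod[of "set S" "insert y (set S - C)"] assms by auto
  then show ?thesis using remove_loss[OF assms(1-3)] by (simp add: marginal_def)
qed

text \<open>The parameter r serves the induction, which adds elements by decreasing probability: the
  term r f (T \<union> Y) absorbs the possibly negative marginal of the next element. The
  application has r = 0 and Y = X, and shows that a random set hitting each element with probability
  at most q costs at most the fraction q of f T.\<close>

lemma expectation_random_subset:
  fixes P :: "'b pmf"
  assumes fin: "finite (set_pmf P)" and "Y \<subseteq> X" "T \<subseteq> X"
    and "\<And>e. e \<in> Y \<Longrightarrow> measure_pmf.prob P {\<omega>. e \<in> A \<omega>} \<le> q"
    and "\<And>e. e \<in> Y \<Longrightarrow> r \<le> measure_pmf.prob P {\<omega>. e \<in> A \<omega>}"
    and "r \<le> q"
  shows "(1 - q) * f T + r * f (T \<union> Y) \<le> measure_pmf.expectation P (\<lambda>\<omega>. f (T \<union> (A \<omega> \<inter> Y)))"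
proof -
  have "finite Y" using assms finite_X finite_subset by blast
  then show ?thesis using assms(2-)
  proof (induction Y arbitrary: r rule: finite_ranking_induct[where f = "\<lambda>e. - measure_pmf.prob P {\<omega>. e \<in> A \<omega>}"])
    case empty
    have "0 \<le> (q - r) * f T" using empty nonneg by auto
    then show ?case by (simp add: algebra_simps)
  next
    case (insert e Y)
    show ?case
    proof (cases "e \<in> Y")
      case True then show ?thesis using insert by (auto simp: insert_absorb)
    next
      case False
      let ?s = "measure_pmf.prob P {\<omega>. e \<in> A \<omega>}"
      \<comment> \<open>On every outcome containing e, the marginal of e over the random part is at
        least its marginal over all of T \<union> Y.\<close>
      have *: "f (T \<union> (A \<omega> \<inter> Y)) + indicator {\<omega>. e \<in> A \<omega>} \<omega> * (f (T \<union> insert e Y) - f (T \<union> Y))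
          \<le> f (T \<union> (A \<omega> \<inter> insert e Y))" for \<omega>
      proof (cases "e \<in> A \<omega>")
        case True
        have "T \<union> (A \<omega> \<inter> insert e Y) \<union> (T \<union> Y) = T \<union> insert e Y" using True by auto
        moreover have "(T \<union> (A \<omega> \<inter> insert e Y)) \<inter> (T \<union> Y) = T \<union> (A \<omega> \<inter> Y)" using False by auto
        moreover have "T \<union> (A \<omega> \<inter> insert e Y) \<subseteq> X" "T \<union> Y \<subseteq> X" using insert.prems by auto
        ultimately show ?thesis
          using submod[of "T \<union> (A \<omega> \<inter> insert e Y)" "T \<union> Y"] True by simp
      qed simp
      \<comment> \<open>All elements added before e have probability at least \<open>?s\<close>, so
        \<open>?s\<close> is an admissible lower bound for Y.\<close>
      have "(1 - q) * f T + ?s * f (T \<union> Y) \<le> measure_pmf.expectation P (\<lambda>\<omega>. f (T \<union> (A \<omega> \<inter> Y)))"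
        using insert by (intro insert.IH) auto
      moreover have "measure_pmf.expectation P (\<lambda>\<omega>. f (T \<union> (A \<omega> \<inter> Y))
           + indicator {\<omega>. e \<in> A \<omega>} \<omega> * (f (T \<union> insert e Y) - f (T \<union> Y)))
          \<le> measure_pmf.expectation P (\<lambda>\<omega>. f (T \<union> (A \<omega> \<inter> insert e Y)))"
        by (intro integral_mono integrable_measure_pmf_finite fin *)
      moreover have "measure_pmf.expectation P (\<lambda>\<omega>. f (T \<union> (A \<omega> \<inter> Y))
           + indicator {\<omega>. e \<in> A \<omega>} \<omega> * (f (T \<union> insert e Y) - f (T \<union> Y)))
        = measure_pmf.expectation P (\<lambda>\<omega>. f (T \<union> (A \<omega> \<inter> Y))) + ?s * (f (T \<union> insert e Y) - f (T \<union> Y))"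
        by (subst Bochner_Integration.integral_add) (auto intro!: integrable_measure_pmf_finite fin)
      moreover have "0 \<le> (?s - r) * f (T \<union> insert e Y)"
        using insert.prems by (intro mult_nonneg_nonneg nonneg) auto
      ultimately show ?thesis by (simp add: algebra_simps)
    qed
  qed
qed

end

section \<open>Charging rejected elements\<close>

text \<open>Compares two sums through their level sets; it replaces the usual injection that maps every
  rejected element of a matroid to a kept element of larger value.\<close>

lemma sum_le_of_level_sets:
  fixes w :: "'a \<Rightarrow> real" and v :: "'b \<Rightarrow> real"
  assumes "finite A" "finite B" "\<And>b. b \<in> B \<Longrightarrow> 0 \<le> v b"
    and "\<And>\<theta>. 0 \<le> \<theta> \<Longrightarrow> card {a \<in> A. \<theta> < w a} \<le> card {b \<in> B. \<theta> < v b}"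
  shows "sum w A \<le> sum v B"
  using assms
proof (induction A arbitrary: B rule: finite_ranking_induct[where f = w])
  case empty
  then show ?case by (simp add: sum_nonneg)
next
  case (insert a A)
  show ?case
  proof (cases "a \<in> A \<or> w a \<le> 0")
    case True
    then consider "a \<in> A" | "w a \<le> 0" by blast
    then show ?thesis
    proof cases
      case 1 then show ?thesis using insert by (simp add: insert_absorb)
    next
      case 2
      then have "sum w (insert a A) \<le> 0" using insert.hyps by (intro sum_nonpos) force
      moreover have "0 \<le> sum v B" using insert.prems by (intro sum_nonneg) auto
      ultimately show ?thesis by linarith
    qed
  next
    case False
    have pos: "card {b \<in> B. \<theta> < v b} > 0" if "0 \<le> \<theta>" "\<theta> < w a" for \<theta>
    proof -
      have "card {x \<in> insert a A. \<theta> < w x} > 0" using that insert.hyps by (auto simp: card_gt_0_iff)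
      then show ?thesis using insert.prems(3)[OF that(1)] by linarith
    qed
    then have "B \<noteq> {}" using False by force
    then obtain b where b: "b \<in> B" "\<And>b'. b' \<in> B \<Longrightarrow> v b' \<le> v b"
      using Max_in[of "v ` B"] Max_ge[of "v ` B"] insert.prems(1)
      by (metis (no_types, lifting) finite_imageI image_iff image_is_empty)
    have wb: "w a \<le> v b"
    proof (rule ccontr)
      assume "\<not> w a \<le> v b"
      then have "card {b' \<in> B. v b < v b'} > 0" using pos[of "v b"] insert.prems(2) b(1) by auto
      then show False using b(2) by (force simp: card_gt_0_iff)
    qed
    \<comment> \<open>The element a has the largest weight. For thresholds below w a both level sets
      lose exactly one element when a and b are dropped; from w a on the left one is empty.\<close>
    have "sum w A \<le> sum v (B - {b})"
    proof (rule insert.IH)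
      fix \<theta> :: real assume "0 \<le> \<theta>"
      show "card {x \<in> A. \<theta> < w x} \<le> card {b' \<in> B - {b}. \<theta> < v b'}"
      proof (cases "\<theta> < w a")
        case True
        have "{x \<in> insert a A. \<theta> < w x} = insert a {x \<in> A. \<theta> < w x}" using True by auto
        moreover have "{b' \<in> B. \<theta> < v b'} = insert b {b' \<in> B - {b}. \<theta> < v b'}" using True wb b by auto
        ultimately show ?thesis using insert.prems(3)[OF \<open>0 \<le> \<theta>\<close>] insert False by simp
      next
        case False
        then have "{x \<in> A. \<theta> < w x} = {}" using insert.hyps by force
        then show ?thesis by (metis card.empty le0)
      qed
    qed (use insert in auto)
    then show ?thesis using wb b insert False by (simp add: sum.remove)
  qed
qed

section \<open>Exchange steps and charging certificates\<close>

locale local_search = objective X f for X :: "'a set" and f +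
  fixes Ms :: "('a set \<times> 'a set set) list" and p :: nat and \<alpha> :: real
  assumes matchoid: "p_matchoid p X Ms" and alpha_pos: "0 < \<alpha>"
begin

lemma matroid_component: "M \<in> set Ms \<Longrightarrow> matroid (fst M) (snd M)"
  using matchoid by (auto simp: p_matchoid_def matroid_def)

lemma card_components_le:
  assumes "x \<in> X" shows "card {M \<in> set Ms. x \<in> fst M} \<le> p"
proof -
  have "card {M \<in> set Ms. x \<in> fst M} = card (set (filter (\<lambda>M. x \<in> fst M) Ms))" by simp
  also have "\<dots> \<le> length (filter (\<lambda>M. x \<in> fst M) Ms)" by (rule card_length)
  finally show ?thesis using matchoid assms by (force simp: p_matchoid_def)
qed

lemma feasible_indep: "S \<in> feasible_sets X Ms \<Longrightarrow> M \<in> set Ms \<Longrightarrow> S \<inter> fst M \<in> snd M"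
  by (auto simp: feasible_sets_def satisfies_def)

lemma feasible_subset_X: "S \<in> feasible_sets X Ms \<Longrightarrow> S \<subseteq> X"
  by (auto simp: feasible_sets_def)

lemma feasible_subset:
  assumes "S \<in> feasible_sets X Ms" "S' \<subseteq> S" shows "S' \<in> feasible_sets X Ms"
proof -
  have "S' \<inter> fst M \<in> snd M" if "M \<in> set Ms" for M
    by (rule matroid.indep_subset[OF matroid_component feasible_indep]) (use that assms in auto)
  then show ?thesis using assms by (auto simp: feasible_sets_def satisfies_def)
qed

lemma empty_feasible: "{} \<in> feasible_sets X Ms"
  using matroid.empty_indep[OF matroid_component] by (auto simp: feasible_sets_def satisfies_def)

definition violated :: "'a list \<Rightarrow> 'a \<Rightarrow> ('a set \<times> 'a set set) set" where
  "violated S x = {M \<in> set Ms. x \<in> fst M \<and> insert x (set S \<inter> fst M) \<notin> snd M}"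

definition circuit :: "'a set \<times> 'a set set \<Rightarrow> 'a list \<Rightarrow> 'a \<Rightarrow> 'a set" where
  "circuit M S x = {z \<in> set S \<inter> fst M. insert x (set S \<inter> fst M - {z}) \<in> snd M}"

definition victim :: "'a set \<times> 'a set set \<Rightarrow> 'a list \<Rightarrow> 'a \<Rightarrow> 'a" where
  "victim M S x = arg_min_on (incr f S) (circuit M S x)"

text \<open>The lower bound \<alpha> > 0 keeps all incremental values positive although f is not
  monotone. Sums over removed elements and level sets above thresholds \<theta> \<ge> 0 rely on this
  sign.\<close>

definition solution :: "'a list \<Rightarrow> bool" where
  "solution S \<longleftrightarrow> distinct S \<and> set S \<in> feasible_sets X Ms \<and> (\<forall>e\<in>set S. \<alpha> \<le> incr f S e)"

definition available :: "'a set" where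
  "available = {x \<in> X. satisfies Ms {x}}"

definition swap :: "'a list \<Rightarrow> 'a \<Rightarrow> 'a list" where
  "swap S y = filter (\<lambda>e. e \<notin> exchange f Ms y S) S @ [y]"

lemma set_swap: "set (swap S y) = insert y (set S - exchange f Ms y S)"
  by (auto simp: swap_def)

lemma exchange_eq: "exchange f Ms x S = (\<lambda>M. victim M S x) ` violated S x"
  by (auto simp: exchange_def victim_def circuit_def violated_def case_prod_unfold intro!: image_cong)

lemma solutionD:
  assumes "solution S"
  shows "distinct S" "set S \<in> feasible_sets X Ms" "set S \<subseteq> X"
    "\<And>e. e \<in> set S \<Longrightarrow> \<alpha> \<le> incr f S e" "\<And>e. e \<in> set S \<Longrightarrow> 0 \<le> incr f S e"
  using assms feasible_subset_X alpha_pos by (force simp: solution_def)+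

text \<open>An element of the solution has marginal 0 and violates no matroid, so \<alpha> > 0
  rejects it. Elements of the initial solution that arrive while still present are therefore not
  buffered.\<close>

lemma accepts_new:
  assumes "solution S" "accepts f Ms \<alpha> \<beta> S x" shows "x \<notin> set S"
proof
  assume x: "x \<in> set S"
  then have "violated S x = {}"
    using feasible_indep[OF solutionD(2)[OF assms(1)]] by (auto simp: violated_def insert_absorb)
  then show False using assms x alpha_pos by (simp add: accepts_def exchange_eq marginal_mem)
qed

lemma available_indep: "x \<in> available \<Longrightarrow> M \<in> set Ms \<Longrightarrow> x \<in> fst M \<Longrightarrow> {x} \<in> snd M"
  by (auto simp: available_def satisfies_def)

lemma feasible_available: "S \<in> feasible_sets X Ms \<Longrightarrow> S \<subseteq> available"
proof
  fix x assume "S \<in> feasible_sets X Ms" "x \<in> S"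
  then have "{x} \<in> feasible_sets X Ms" using feasible_subset[of S "{x}"] by simp
  then show "x \<in> available" by (auto simp: available_def feasible_sets_def)
qed

context
  fixes S x assumes S: "solution S" and x: "x \<in> available"
begin

lemma victim_mem:
  assumes "M \<in> violated S x" shows "victim M S x \<in> circuit M S x"
    and "\<And>z. z \<in> circuit M S x \<Longrightarrow> incr f S (victim M S x) \<le> incr f S z"
proof -
  have M: "M \<in> set Ms" "x \<in> fst M" "insert x (set S \<inter> fst M) \<notin> snd M"
    using assms by (auto simp: violated_def)
  have "circuit M S x \<noteq> {}"
    unfolding circuit_def
    by (rule matroid.circuit_nonempty[OF matroid_component feasible_indep])
      (use M S available_indep[OF x M(1,2)] in \<open>auto simp: solution_def\<close>)
  moreover have "finite (circuit M S x)" by (simp add: circuit_def)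
  ultimately show "victim M S x \<in> circuit M S x"
    and "\<And>z. z \<in> circuit M S x \<Longrightarrow> incr f S (victim M S x) \<le> incr f S z"
    unfolding victim_def by (auto intro: arg_min_if_finite arg_min_least)
qed

lemma exchange_subset: "exchange f Ms x S \<subseteq> set S"
  using victim_mem(1) by (auto simp: exchange_eq circuit_def)

lemma finite_exchange: "finite (exchange f Ms x S)"
  using exchange_subset finite_subset by blast

text \<open>Every violated matroid loses the victim chosen for it, which restores independence;
  removals made for other matroids do no harm.\<close>

lemma swap_feasible: "set (swap S x) \<in> feasible_sets X Ms"
proof -
  let ?C = "exchange f Ms x S"
  have "set (swap S x) \<inter> fst M \<in> snd M" if M: "M \<in> set Ms" for M
  proof -
    interpret matroid "fst M" "snd M" by (rule matroid_component[OF M])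
    have ind: "set S \<inter> fst M \<in> snd M" using feasible_indep M S by (auto simp: solution_def)
    consider "x \<notin> fst M" | "x \<in> fst M" "M \<notin> violated S x" | "x \<in> fst M" "M \<in> violated S x" by blast
    then show ?thesis
    proof cases
      case 1 then show ?thesis by (intro indep_subset[OF ind]) (auto simp: set_swap)
    next
      case 2
      then have "insert x (set S \<inter> fst M) \<in> snd M" using M by (auto simp: violated_def)
      then show ?thesis by (rule indep_subset) (auto simp: set_swap)
    next
      case 3
      then have "insert x (set S \<inter> fst M - {victim M S x}) \<in> snd M"
        using victim_mem(1) by (auto simp: circuit_def)
      then show ?thesis by (rule indep_subset) (use 3 in \<open>auto simp: set_swap exchange_eq\<close>)
    qed
  qed
  moreover have "set (swap S x) \<subseteq> X" using x S by (auto simp: set_swap available_def solution_def feasible_sets_def)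
  ultimately show ?thesis by (auto simp: feasible_sets_def satisfies_def)
qed

lemma sum_exchange_nonneg: "0 \<le> (\<Sum>c\<in>exchange f Ms x S. incr f S c)"
  using exchange_subset solutionD(5)[OF S] by (intro sum_nonneg) auto

lemma incr_swap_old:
  assumes "e \<in> set S" "e \<notin> exchange f Ms x S"
  shows "incr f S e \<le> incr f (swap S x) e"
  using assms solutionD(3)[OF S] incr_filter_ge[of S e "\<lambda>e. e \<notin> exchange f Ms x S"]
  by (simp add: swap_def incr_snoc)

text \<open>The prefix in front of the appended element is the solution without the exchanged
  elements, so its value is at least the marginal tested by \<open>accepts\<close>.\<close>

lemma incr_swap_new:
  assumes "accepts f Ms \<alpha> \<beta> S x"
  shows "\<alpha> + (1 + \<beta>) * (\<Sum>c\<in>exchange f Ms x S. incr f S c) \<le> incr f (swap S x) x"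
proof -
  have new: "x \<notin> set S" by (rule accepts_new[OF S assms])
  have "marginal f x (set S) \<le> marginal f x (set S - exchange f Ms x S)"
    using new solutionD(3)[OF S] x by (intro marginal_antimono) (auto simp: available_def)
  moreover have "incr f (swap S x) x = marginal f x (set S - exchange f Ms x S)"
    using new by (simp add: swap_def incr_snoc set_diff_eq)
  ultimately show ?thesis using assms by (simp add: accepts_def)
qed

lemma solution_swap:
  assumes "accepts f Ms \<alpha> \<beta> S x" "0 \<le> \<beta>" shows "solution (swap S x)"
  unfolding solution_def
proof (intro conjI ballI)
  show "distinct (swap S x)" using solutionD(1)[OF S] accepts_new[OF S assms(1)] by (auto simp: swap_def)
  show "set (swap S x) \<in> feasible_sets X Ms" by (rule swap_feasible)
  fix e assume "e \<in> set (swap S x)"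
  then consider "e = x" | "e \<in> set S" "e \<notin> exchange f Ms x S" by (auto simp: set_swap)
  then show "\<alpha> \<le> incr f (swap S x) e"
  proof cases
    case 1
    have "0 \<le> (1 + \<beta>) * (\<Sum>c\<in>exchange f Ms x S. incr f S c)"
      using assms(2) sum_exchange_nonneg by (intro mult_nonneg_nonneg) auto
    then show ?thesis using incr_swap_new[OF assms(1)] 1 by simp
  next
    case 2 then show ?thesis using incr_swap_old solutionD(4)[OF S] by force
  qed
qed

text \<open>Of the 1 + \<beta> copies of the removed value in the acceptance test, one pays for the
  loss. What remains is \<alpha>, used for the probability estimate, and \<beta> times the removed
  value, used for the charging.\<close>

lemma swap_value:
  assumes "accepts f Ms \<alpha> \<beta> S x"
  shows "marginal f x (set S) - (\<Sum>c\<in>exchange f Ms x S. incr f S c) \<le> f (set (swap S x)) - f (set S)"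
    and "\<alpha> + \<beta> * (\<Sum>c\<in>exchange f Ms x S. incr f S c) \<le> f (set (swap S x)) - f (set S)"
proof -
  show *: "marginal f x (set S) - (\<Sum>c\<in>exchange f Ms x S. incr f S c) \<le> f (set (swap S x)) - f (set S)"
    unfolding set_swap
    by (rule swap_gain) (use S x solutionD[OF S] exchange_subset accepts_new[OF S assms] in \<open>auto simp: available_def\<close>)
  show "\<alpha> + \<beta> * (\<Sum>c\<in>exchange f Ms x S. incr f S c) \<le> f (set (swap S x)) - f (set S)"
    using * assms by (simp add: accepts_def algebra_simps)
qed

end

text \<open>The pairs in \<open>Z M\<close> are elements of \<open>M\<close> that were removed on account of another matroid, with
  their incremental value at that time: in \<open>M\<close> nothing replaces them.\<close>

definition valued :: "'a set \<times> 'a set set \<Rightarrow> 'a list \<Rightarrow> ('a \<times> real) set \<Rightarrow> ('a \<times> real) set" where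
  "valued M S Z = (\<lambda>s. (s, incr f S s)) ` (set S \<inter> fst M) \<union> Z"

definition above :: "real \<Rightarrow> ('a \<times> real) set \<Rightarrow> 'a set" where
  "above \<theta> Q = fst ` {z \<in> Q. \<theta> < snd z}"

text \<open>A certificate for a set J of rejected elements: e charges w M e to each matroid M
  containing it. Containment in a span at every threshold \<theta>, instead of an explicit map into
  the solution, makes the certificate stable under swaps, since spans compose by
  \<open>span_trans\<close>. R stands for the total incremental value removed, for which the pairs
  in Z pay at most p - 1 times.\<close>

definition charging where
  "charging \<beta> S A J R w Z \<longleftrightarrow>
     (\<forall>e\<in>J. marginal f e A \<le> \<alpha> + (1 + \<beta>) * (\<Sum>M\<in>{M \<in> set Ms. e \<in> fst M}. w M e)) \<and>
     (\<forall>M\<in>set Ms. finite (Z M) \<and> (\<forall>z\<in>Z M. 0 \<le> snd z)) \<and>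
     (\<forall>M\<in>set Ms. \<forall>\<theta>\<ge>0. {e \<in> J \<inter> fst M. \<theta> < w M e} \<subseteq> matroid.span (snd M) (above \<theta> (valued M S (Z M)))) \<and>
     (\<Sum>M\<in>set Ms. \<Sum>z\<in>Z M. snd z) \<le> (real p - 1) * R"

definition charged :: "real \<Rightarrow> 'a list \<Rightarrow> 'a set \<Rightarrow> 'a set \<Rightarrow> real \<Rightarrow> bool" where
  "charged \<beta> S A J R \<longleftrightarrow> (\<exists>w Z. charging \<beta> S A J R w Z)"

lemma chargingI:
  assumes "\<And>e. e \<in> J \<Longrightarrow> marginal f e A \<le> \<alpha> + (1 + \<beta>) * (\<Sum>M\<in>{M \<in> set Ms. e \<in> fst M}. w M e)"
    and "\<And>M. M \<in> set Ms \<Longrightarrow> finite (Z M)"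
    and "\<And>M z. M \<in> set Ms \<Longrightarrow> z \<in> Z M \<Longrightarrow> 0 \<le> snd z"
    and "\<And>M e \<theta>. M \<in> set Ms \<Longrightarrow> e \<in> J \<Longrightarrow> e \<in> fst M \<Longrightarrow> 0 \<le> \<theta> \<Longrightarrow> \<theta> < w M e \<Longrightarrow>
        e \<in> matroid.span (snd M) (above \<theta> (valued M S (Z M)))"
    and "(\<Sum>M\<in>set Ms. \<Sum>z\<in>Z M. snd z) \<le> (real p - 1) * R"
  shows "charging \<beta> S A J R w Z"
  unfolding charging_def using assms by (intro conjI ballI allI impI subsetI) auto

lemma chargingD:
  assumes "charging \<beta> S A J R w Z"
  shows "\<And>e. e \<in> J \<Longrightarrow> marginal f e A \<le> \<alpha> + (1 + \<beta>) * (\<Sum>M\<in>{M \<in> set Ms. e \<in> fst M}. w M e)"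
    and "\<And>M. M \<in> set Ms \<Longrightarrow> finite (Z M)"
    and "\<And>M z. M \<in> set Ms \<Longrightarrow> z \<in> Z M \<Longrightarrow> 0 \<le> snd z"
    and "\<And>M e \<theta>. M \<in> set Ms \<Longrightarrow> e \<in> J \<Longrightarrow> e \<in> fst M \<Longrightarrow> 0 \<le> \<theta> \<Longrightarrow> \<theta> < w M e \<Longrightarrow>
        e \<in> matroid.span (snd M) (above \<theta> (valued M S (Z M)))"
    and "(\<Sum>M\<in>set Ms. \<Sum>z\<in>Z M. snd z) \<le> (real p - 1) * R"
proof -
  note * = assms[unfolded charging_def]
  show "\<And>e. e \<in> J \<Longrightarrow> marginal f e A \<le> \<alpha> + (1 + \<beta>) * (\<Sum>M\<in>{M \<in> set Ms. e \<in> fst M}. w M e)"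
    using * by blast
  show "finite (Z M)" if "M \<in> set Ms" for M using * that by blast
  show "0 \<le> snd z" if "M \<in> set Ms" "z \<in> Z M" for M z using * that by blast
  show "e \<in> matroid.span (snd M) (above \<theta> (valued M S (Z M)))"
    if "M \<in> set Ms" "e \<in> J" "e \<in> fst M" "0 \<le> \<theta>" "\<theta> < w M e" for M e \<theta>
  proof -
    have "{e \<in> J \<inter> fst M. \<theta> < w M e} \<subseteq> matroid.span (snd M) (above \<theta> (valued M S (Z M)))"
      using * that(1,4) by blast
    then show ?thesis using that by auto
  qed
  show "(\<Sum>M\<in>set Ms. \<Sum>z\<in>Z M. snd z) \<le> (real p - 1) * R" using * by blast
qed

lemma charged_empty: "charged \<beta> S A {} 0"
  unfolding charged_def by (rule exI, rule exI[of _ "\<lambda>_. {}"], rule chargingI) auto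

text \<open>For every violated matroid x charges the value of its victim. As the victim is minimal
  in the circuit, any threshold below its value is exceeded by the whole circuit, which spans x. By
  x \<notin> A the marginal at A is at most the marginal at the current solution.\<close>

lemma charged_reject:
  assumes ch: "charged \<beta> S A J R" and S: "solution S" "set S \<subseteq> A" "A \<subseteq> X"
    and x: "x \<in> available" "x \<notin> A" "\<not> accepts f Ms \<alpha> \<beta> S x" and "0 \<le> \<beta>"
  shows "charged \<beta> S A (insert x J) R"
proof -
  obtain w Z where wZ: "charging \<beta> S A J R w Z" using ch unfolding charged_def by blast
  note w = chargingD(1)[OF wZ] and sp = chargingD(4)[OF wZ]
  define w' where "w' M e = (if e = x then if M \<in> violated S x then incr f S (victim M S x) else 0 else w M e)" for M e
  have "marginal f x A \<le> \<alpha> + (1 + \<beta>) * (\<Sum>M\<in>{M \<in> set Ms. x \<in> fst M}. w' M x)"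
  proof -
    have "marginal f x A \<le> marginal f x (set S)"
      using S x by (intro marginal_antimono) (auto simp: available_def)
    also have "\<dots> \<le> \<alpha> + (1 + \<beta>) * (\<Sum>c\<in>exchange f Ms x S. incr f S c)"
      using x by (simp add: accepts_def)
    \<comment> \<open>One element can be the victim of several matroids; the right side counts it
      once for each of them, which is allowed as values are nonnegative.\<close>
    also have "(\<Sum>c\<in>exchange f Ms x S. incr f S c) \<le> (\<Sum>M\<in>violated S x. incr f S (victim M S x))"
      unfolding exchange_eq
      using victim_mem(1)[OF S(1) x(1)] solutionD(5)[OF S(1)]
      by (intro order_trans[OF sum_image_le]) (auto simp: violated_def circuit_def)
    also have "\<dots> = (\<Sum>M\<in>violated S x. w' M x)" by (intro sum.cong) (auto simp: w'_def)
    also have "\<dots> = (\<Sum>M\<in>{M \<in> set Ms. x \<in> fst M}. w' M x)"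
      by (intro sum.mono_neutral_left) (auto simp: w'_def violated_def)
    finally show ?thesis using \<open>0 \<le> \<beta>\<close> by simp
  qed
  note new = this
  have spn: "x \<in> matroid.span (snd M) (above \<theta> (valued M S (Z M)))"
    if "M \<in> set Ms" "0 \<le> \<theta>" "\<theta> < w' M x" for M \<theta>
  proof -
    interpret matroid "fst M" "snd M" by (rule matroid_component) fact
    have M: "M \<in> violated S x" using that by (auto simp: w'_def split: if_splits)
    then have "x \<in> span (circuit M S x)"
      by (intro circuit_spans_new[OF _ _ circuit_def] feasible_indep[OF solutionD(2)[OF S(1)]])
        (auto simp: violated_def)
    moreover have "circuit M S x \<subseteq> above \<theta> (valued M S (Z M))"
    proof
      fix z assume z: "z \<in> circuit M S x"
      then have "\<theta> < incr f S z"
        using victim_mem(2)[OF S(1) x(1) M z] that M by (simp add: w'_def)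
      then have "(z, incr f S z) \<in> {z \<in> valued M S (Z M). \<theta> < snd z}" using z by (auto simp: circuit_def valued_def)
      then show "z \<in> above \<theta> (valued M S (Z M))" unfolding above_def by (metis fst_conv imageI)
    qed
    ultimately show ?thesis using span_mono by blast
  qed
  have "charging \<beta> S A (insert x J) R w' Z"
  proof (rule chargingI)
    fix e assume "e \<in> insert x J"
    then show "marginal f e A \<le> \<alpha> + (1 + \<beta>) * (\<Sum>M\<in>{M \<in> set Ms. e \<in> fst M}. w' M e)"
      using new w[of e] by (cases "e = x") (auto simp: w'_def)
  next
    fix M e \<theta> assume "M \<in> set Ms" "e \<in> insert x J" "e \<in> fst M" "0 \<le> (\<theta>::real)" "\<theta> < w' M e"
    then show "e \<in> matroid.span (snd M) (above \<theta> (valued M S (Z M)))"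
      using spn[of M \<theta>] sp[of M e \<theta>] by (cases "e = x") (simp_all add: w'_def)
  qed (use chargingD[OF wZ] in blast)+
  then show ?thesis unfolding charged_def by blast
qed

lemma charged_reject_set:
  assumes "finite K" "charged \<beta> S A J R" "solution S" "set S \<subseteq> A" "A \<subseteq> X" "0 \<le> \<beta>"
    "\<And>x. x \<in> K \<Longrightarrow> x \<in> available \<and> x \<notin> A \<and> \<not> accepts f Ms \<alpha> \<beta> S x"
  shows "charged \<beta> S A (J \<union> K) R"
  using assms
proof (induction K rule: finite_induct)
  case (insert x K)
  then have "charged \<beta> S A (insert x (J \<union> K)) R" by (intro charged_reject) auto
  then show ?case by simp
qed simp

lemma aboveI: "(s, v) \<in> Q \<Longrightarrow> \<theta> < v \<Longrightarrow> s \<in> above \<theta> Q"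
  unfolding above_def by (metis (mono_tags, lifting) fst_conv image_eqI mem_Collect_eq snd_conv)

lemma valued_new: "s \<in> set S \<Longrightarrow> s \<in> fst M \<Longrightarrow> (s, incr f S s) \<in> valued M S Z"
  by (auto simp: valued_def)

text \<open>If the victim s of M exceeds \<theta>, so do the rest of its circuit, by minimality, and
  y, by the acceptance test; together they span s. Removed elements not chosen by M stay as pairs in
  \<open>Z'\<close>. Hence no span of a level set shrinks.\<close>

lemma charged_swap:
  assumes ch: "charged \<beta> S A J R" and S: "solution S" "set S \<subseteq> A" "A \<subseteq> X"
    and y: "y \<in> available" "accepts f Ms \<alpha> \<beta> S y" and "0 \<le> \<beta>" and J: "J \<subseteq> X" "y \<notin> J"
  shows "charged \<beta> (swap S y) (insert y A) J (R + (\<Sum>c\<in>exchange f Ms y S. incr f S c))"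
proof -
  let ?C = "exchange f Ms y S"
  obtain w Z where wZ: "charging \<beta> S A J R w Z" using ch unfolding charged_def by blast
  define own where "own M c \<longleftrightarrow> M \<in> violated S y \<and> c = victim M S y" for M c
  define lost where "lost M = (\<lambda>c. (c, incr f S c)) ` {c \<in> ?C \<inter> fst M. \<not> own M c}" for M
  define Z' where "Z' M = Z M \<union> lost M" for M
  have finC: "finite ?C" and CS: "?C \<subseteq> set S"
    by (fact finite_exchange[OF S(1) y(1)], fact exchange_subset[OF S(1) y(1)])
  have Cpos: "0 \<le> incr f S c" if "c \<in> ?C" for c using solutionD(5)[OF S(1)] CS that by blast
  \<comment> \<open>By \<alpha> > 0 and 1 + \<beta> \<ge> 1 the new element is worth more than each
    removed one, so it belongs to every level set that contained a removed element.\<close>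
  have dom: "incr f S c < incr f (swap S y) y" if "c \<in> ?C" for c
  proof -
    have "incr f S c \<le> (\<Sum>c\<in>?C. incr f S c)"
      using that finC Cpos by (intro member_le_sum) auto
    also have "\<dots> \<le> (1 + \<beta>) * (\<Sum>c\<in>?C. incr f S c)"
      using \<open>0 \<le> \<beta>\<close> sum_exchange_nonneg[OF S(1) y(1)] by (simp add: mult_le_cancel_right1)
    also have "\<dots> < incr f (swap S y) y"
      using incr_swap_new[OF S(1) y] alpha_pos by linarith
    finally show ?thesis .
  qed
  have span: "above \<theta> (valued M S (Z M)) \<subseteq> matroid.span (snd M) (above \<theta> (valued M (swap S y) (Z' M)))"
    if M: "M \<in> set Ms" for M \<theta>
  proof
    interpret matroid "fst M" "snd M" by (rule matroid_component[OF M])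
    let ?U = "above \<theta> (valued M (swap S y) (Z' M))"
    have kept: "s \<in> ?U" if "s \<in> set S" "s \<in> fst M" "\<theta> < incr f S s" "\<not> own M s" for s
    proof (cases "s \<in> ?C")
      case True
      then have "(s, incr f S s) \<in> Z' M" using that by (auto simp: Z'_def lost_def)
      then show ?thesis using that by (intro aboveI[of s "incr f S s"]) (auto simp: valued_def)
    next
      case False
      then show ?thesis
        using that incr_swap_old[OF S(1) y(1) that(1) False]
        by (intro aboveI[OF valued_new]) (auto simp: set_swap)
    qed
    fix s assume "s \<in> above \<theta> (valued M S (Z M))"
    then consider v where "(s, v) \<in> Z M" "\<theta> < v" | "s \<in> set S" "s \<in> fst M" "\<theta> < incr f S s"
      by (auto simp: above_def valued_def)
    then show "s \<in> span ?U"
    proof cases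
      case 1
      then have "s \<in> ?U" by (intro aboveI[of s v]) (auto simp: valued_def Z'_def)
      then show ?thesis using subset_span by blast
    next
      case 2
      show ?thesis
      proof (cases "own M s")
        case False then show ?thesis using kept[OF 2] subset_span by blast
      next
        case True
        then have v: "M \<in> violated S y" "s = victim M S y" by (auto simp: own_def)
        then have s: "s \<in> circuit M S y" using victim_mem(1)[OF S(1) y(1)] by simp
        have "s \<in> span (insert y (circuit M S y - {s}))"
          using v by (intro circuit_spans_old[OF _ _ circuit_def s] feasible_indep[OF solutionD(2)[OF S(1)]])
            (auto simp: violated_def)
        moreover have "insert y (circuit M S y - {s}) \<subseteq> ?U"
        proof
          fix z assume "z \<in> insert y (circuit M S y - {s})"
          then consider "z = y" | "z \<in> circuit M S y" "z \<noteq> s" by blast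
          then show "z \<in> ?U"
          proof cases
            case 1
            have "s \<in> ?C" using v by (simp add: exchange_eq)
            then have "\<theta> < incr f (swap S y) y" using dom 2(3) by force
            then show ?thesis
              using 1 v by (intro aboveI[OF valued_new]) (auto simp: set_swap violated_def)
          next
            case 2
            then have "\<theta> < incr f S z"
              using victim_mem(2)[OF S(1) y(1) v(1), of z] v(2) \<open>\<theta> < incr f S s\<close> by simp
            then show ?thesis using 2 v by (intro kept) (auto simp: circuit_def own_def)
          qed
        qed
        ultimately show ?thesis using span_mono by blast
      qed
    qed
  qed
  have "charging \<beta> (swap S y) (insert y A) J (R + (\<Sum>c\<in>?C. incr f S c)) w Z'"
  proof (rule chargingI)
    fix e assume "e \<in> J"
    then have "marginal f e (insert y A) \<le> marginal f e A"
      using J S y by (intro marginal_antimono) (auto simp: available_def)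
    then show "marginal f e (insert y A) \<le> \<alpha> + (1 + \<beta>) * (\<Sum>M\<in>{M \<in> set Ms. e \<in> fst M}. w M e)"
      using chargingD(1)[OF wZ \<open>e \<in> J\<close>] by linarith
  next
    fix M assume "M \<in> set Ms"
    then show "finite (Z' M)" using chargingD(2)[OF wZ] finC by (auto simp: Z'_def lost_def)
  next
    fix M z assume "M \<in> set Ms" "z \<in> Z' M"
    then show "0 \<le> snd z" using chargingD(3)[OF wZ, of M z] Cpos by (auto simp: Z'_def lost_def)
  next
    fix M e \<theta> assume M: "M \<in> set Ms" and e: "e \<in> J" "e \<in> fst M" "0 \<le> (\<theta>::real)" "\<theta> < w M e"
    show "e \<in> matroid.span (snd M) (above \<theta> (valued M (swap S y) (Z' M)))"
      by (rule matroid.span_trans[OF matroid_component[OF M] span[OF M] chargingD(4)[OF wZ M e]])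
  next
    have "(\<Sum>z\<in>Z' M. snd z) \<le> (\<Sum>z\<in>Z M. snd z) + (\<Sum>c\<in>?C. if c \<in> fst M \<and> \<not> own M c then incr f S c else 0)"
      if M: "M \<in> set Ms" for M
    proof -
      \<comment> \<open>A pair may already be present if an element was removed before with the same
        value. The union counts it once, and nonnegativity gives the inequality in the right
        direction.\<close>
      have "(\<Sum>z\<in>Z' M. snd z) + (\<Sum>z\<in>Z M \<inter> lost M. snd z) = (\<Sum>z\<in>Z M. snd z) + (\<Sum>z\<in>lost M. snd z)"
        unfolding Z'_def using chargingD(2)[OF wZ M] finC by (intro sum.union_inter) (auto simp: lost_def)
      moreover have "0 \<le> (\<Sum>z\<in>Z M \<inter> lost M. snd z)"
        using chargingD(3)[OF wZ M] by (intro sum_nonneg) auto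
      moreover have "(\<Sum>z\<in>lost M. snd z) = (\<Sum>c\<in>{c \<in> ?C \<inter> fst M. \<not> own M c}. incr f S c)"
        unfolding lost_def by (subst sum.reindex) (auto intro: inj_onI)
      moreover have "\<dots> = (\<Sum>c\<in>?C. if c \<in> fst M \<and> \<not> own M c then incr f S c else 0)"
        using finC by (subst sum.inter_filter[symmetric]) (auto intro: sum.cong)
      ultimately show ?thesis by linarith
    qed
    then have "(\<Sum>M\<in>set Ms. \<Sum>z\<in>Z' M. snd z) \<le> (\<Sum>M\<in>set Ms. (\<Sum>z\<in>Z M. snd z) +
        (\<Sum>c\<in>?C. if c \<in> fst M \<and> \<not> own M c then incr f S c else 0))"
      by (rule sum_mono)
    also have "\<dots> = (\<Sum>M\<in>set Ms. \<Sum>z\<in>Z M. snd z) +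
        (\<Sum>c\<in>?C. \<Sum>M\<in>set Ms. if c \<in> fst M \<and> \<not> own M c then incr f S c else 0)"
      by (subst sum.swap) (simp add: sum.distrib)
    also have "(\<Sum>c\<in>?C. \<Sum>M\<in>set Ms. if c \<in> fst M \<and> \<not> own M c then incr f S c else 0)
        \<le> (\<Sum>c\<in>?C. (real p - 1) * incr f S c)"
    proof (rule sum_mono)
      fix c assume c: "c \<in> ?C"
      \<comment> \<open>Every removed c is the victim of some matroid M0, so at most p - 1 of the
        matroids containing c record it as lost.\<close>
      let ?N = "{M \<in> set Ms. c \<in> fst M \<and> \<not> own M c}"
      obtain M0 where M0: "own M0 c" using c by (auto simp: own_def exchange_eq)
      then have "M0 \<in> set Ms" "c \<in> fst M0"
        using victim_mem(1)[OF S(1) y(1)] by (auto simp: own_def violated_def circuit_def)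
      then have "insert M0 ?N \<subseteq> {M \<in> set Ms. c \<in> fst M}" by auto
      then have "card (insert M0 ?N) \<le> card {M \<in> set Ms. c \<in> fst M}" by (intro card_mono) auto
      also have "\<dots> \<le> p" using card_components_le CS c S by blast
      finally have "Suc (card ?N) \<le> p" using M0 by simp
      then have "real (card ?N) \<le> real p - 1" by simp
      moreover have "(\<Sum>M\<in>set Ms. if c \<in> fst M \<and> \<not> own M c then incr f S c else 0) = real (card ?N) * incr f S c"
        by (subst sum.inter_filter[symmetric]) auto
      ultimately show "(\<Sum>M\<in>set Ms. if c \<in> fst M \<and> \<not> own M c then incr f S c else 0) \<le> (real p - 1) * incr f S c"
        using Cpos[OF c] by (simp add: mult_right_mono)
    qed
    finally have "(\<Sum>M\<in>set Ms. \<Sum>z\<in>Z' M. snd z)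
        \<le> (\<Sum>M\<in>set Ms. \<Sum>z\<in>Z M. snd z) + (\<Sum>c\<in>?C. (real p - 1) * incr f S c)" by simp
    then show "(\<Sum>M\<in>set Ms. \<Sum>z\<in>Z' M. snd z) \<le> (real p - 1) * (R + (\<Sum>c\<in>?C. incr f S c))"
      using chargingD(5)[OF wZ] unfolding sum_distrib_left[symmetric] distrib_left by linarith
  qed
  then show ?thesis unfolding charged_def by blast
qed

text \<open>In each matroid the elements of J with charge above \<theta> are independent and spanned
  by the level set of \<open>valued\<close>, so there are no more of them;
  \<open>sum_le_of_level_sets\<close> turns this into an inequality of sums. Over all matroids each
  solution element is counted at most p times.\<close>

lemma charged_bound:
  assumes ch: "charged \<beta> S A J R" and S: "solution S" and J: "J \<in> feasible_sets X Ms" and "0 \<le> \<beta>"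
  shows "(\<Sum>e\<in>J. marginal f e A)
    \<le> real (card J) * \<alpha> + (1 + \<beta>) * (real p * f (set S) + (real p - 1) * R)"
proof -
  obtain w Z where wZ: "charging \<beta> S A J R w Z" using ch unfolding charged_def by blast
  have finJ: "finite J" using feasible_subset_X[OF J] finite_X finite_subset by blast
  have swp: "(\<Sum>x\<in>K. \<Sum>M\<in>{M \<in> set Ms. x \<in> fst M}. g M x) = (\<Sum>M\<in>set Ms. \<Sum>x\<in>K \<inter> fst M. g M x)"
    if "finite K" for g :: "'a set \<times> 'a set set \<Rightarrow> 'a \<Rightarrow> real" and K
    using sum.swap_restrict[OF that finite_set[of Ms], of "\<lambda>x M. g M x" "\<lambda>x M. x \<in> fst M"]
    by (simp add: Int_def)
  have one: "(\<Sum>e\<in>J \<inter> fst M. w M e) \<le> (\<Sum>s\<in>set S \<inter> fst M. incr f S s) + (\<Sum>z\<in>Z M. snd z)"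
    if M: "M \<in> set Ms" for M
  proof -
    interpret matroid "fst M" "snd M" by (rule matroid_component[OF M])
    let ?Q = "valued M S (Z M)"
    have finQ: "finite ?Q" using chargingD(2)[OF wZ M] by (simp add: valued_def)
    have "(\<Sum>e\<in>J \<inter> fst M. w M e) \<le> (\<Sum>z\<in>?Q. snd z)"
    proof (rule sum_le_of_level_sets)
      fix \<theta> :: real assume \<theta>: "0 \<le> \<theta>"
      have "card {a \<in> J \<inter> fst M. \<theta> < w M a} \<le> card (above \<theta> ?Q)"
      proof (rule indep_card_le_spanning)
        show "{a \<in> J \<inter> fst M. \<theta> < w M a} \<in> snd M"
          by (rule indep_subset[OF feasible_indep[OF J M]]) auto
        show "{a \<in> J \<inter> fst M. \<theta> < w M a} \<subseteq> span (above \<theta> ?Q)"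
          using chargingD(4)[OF wZ M _ _ \<theta>] by auto
        show "finite (above \<theta> ?Q)" using finQ by (simp add: above_def)
      qed
      also have "\<dots> \<le> card {z \<in> ?Q. \<theta> < snd z}" unfolding above_def using finQ by (intro card_image_le) auto
      finally show "card {a \<in> J \<inter> fst M. \<theta> < w M a} \<le> card {z \<in> ?Q. \<theta> < snd z}" .
    next
      fix z assume "z \<in> ?Q"
      then show "0 \<le> snd z" using chargingD(3)[OF wZ M, of z] solutionD(5)[OF S] by (auto simp: valued_def)
    qed (use finJ finQ in auto)
    also have "\<dots> \<le> (\<Sum>z\<in>(\<lambda>s. (s, incr f S s)) ` (set S \<inter> fst M). snd z) + (\<Sum>z\<in>Z M. snd z)"
    proof -
      let ?P = "(\<lambda>s. (s, incr f S s)) ` (set S \<inter> fst M)"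
      have "(\<Sum>z\<in>?Q. snd z) + (\<Sum>z\<in>?P \<inter> Z M. snd z) = (\<Sum>z\<in>?P. snd z) + (\<Sum>z\<in>Z M. snd z)"
        unfolding valued_def using chargingD(2)[OF wZ M] by (intro sum.union_inter) auto
      moreover have "0 \<le> (\<Sum>z\<in>?P \<inter> Z M. snd z)"
        using chargingD(3)[OF wZ M] by (intro sum_nonneg) auto
      ultimately show ?thesis by linarith
    qed
    also have "(\<Sum>z\<in>(\<lambda>s. (s, incr f S s)) ` (set S \<inter> fst M). snd z) = (\<Sum>s\<in>set S \<inter> fst M. incr f S s)"
      by (subst sum.reindex) (auto intro: inj_onI)
    finally show ?thesis .
  qed
  have "(\<Sum>M\<in>set Ms. \<Sum>s\<in>set S \<inter> fst M. incr f S s) = (\<Sum>s\<in>set S. real (card {M \<in> set Ms. s \<in> fst M}) * incr f S s)"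
    using swp[OF finite_set[of S], of "\<lambda>M s. incr f S s"] by simp
  also have "\<dots> \<le> (\<Sum>s\<in>set S. real p * incr f S s)"
    using card_components_le solutionD(3,5)[OF S] by (intro sum_mono mult_right_mono) auto
  also have "\<dots> = real p * (f (set S) - f {})"
    using sum_incr[OF solutionD(1)[OF S]] by (simp add: sum_distrib_left[symmetric])
  also have "\<dots> \<le> real p * f (set S)" using nonneg[of "{}"] by (intro mult_left_mono) auto
  finally have "(\<Sum>M\<in>set Ms. \<Sum>s\<in>set S \<inter> fst M. incr f S s) \<le> real p * f (set S)" .
  moreover have "(\<Sum>M\<in>set Ms. \<Sum>e\<in>J \<inter> fst M. w M e)
      \<le> (\<Sum>M\<in>set Ms. (\<Sum>s\<in>set S \<inter> fst M. incr f S s) + (\<Sum>z\<in>Z M. snd z))"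
    by (intro sum_mono one)
  ultimately have *: "(\<Sum>M\<in>set Ms. \<Sum>e\<in>J \<inter> fst M. w M e) \<le> real p * f (set S) + (real p - 1) * R"
    using chargingD(5)[OF wZ] by (simp add: sum.distrib)
  have "(\<Sum>e\<in>J. marginal f e A) \<le> (\<Sum>e\<in>J. \<alpha> + (1 + \<beta>) * (\<Sum>M\<in>{M \<in> set Ms. e \<in> fst M}. w M e))"
    by (intro sum_mono chargingD(1)[OF wZ])
  also have "\<dots> = real (card J) * \<alpha> + (1 + \<beta>) * (\<Sum>M\<in>set Ms. \<Sum>e\<in>J \<inter> fst M. w M e)"
    by (simp add: sum.distrib sum_distrib_left[symmetric] swp[OF finJ])
  also have "\<dots> \<le> real (card J) * \<alpha> + (1 + \<beta>) * (real p * f (set S) + (real p - 1) * R)"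
    using * \<open>0 \<le> \<beta>\<close> by (intro add_left_mono mult_left_mono) auto
  finally show ?thesis .
qed

end

section \<open>One pass\<close>

lemma expectation_bind:
  fixes h :: "'b \<Rightarrow> real"
  assumes "finite (set_pmf p)" "\<And>x. x \<in> set_pmf p \<Longrightarrow> finite (set_pmf (g x))"
  shows "measure_pmf.expectation (p \<bind> g) h
    = measure_pmf.expectation p (\<lambda>x. measure_pmf.expectation (g x) h)"
  using assms by (subst pmf_expectation_bind[of "set_pmf p"])
    (auto simp: integral_measure_pmf[of "set_pmf p"])

lemma expectation_mono:
  fixes g h :: "'b \<Rightarrow> real"
  assumes "finite (set_pmf p)" "\<And>x. x \<in> set_pmf p \<Longrightarrow> g x \<le> h x"
  shows "measure_pmf.expectation p g \<le> measure_pmf.expectation p h"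
  using assms by (intro integral_mono_AE) (auto simp: AE_measure_pmf_iff integrable_measure_pmf_finite)

section \<open>The invariant of a pass and the potential argument\<close>

context local_search begin

lemma charged_subset:
  assumes "charged \<beta> S A J R" "J' \<subseteq> J" shows "charged \<beta> S A J' R"
proof -
  obtain w Z where "charging \<beta> S A J R w Z" using assms(1) unfolding charged_def by blast
  note D = chargingD[OF this]
  have "charging \<beta> S A J' R w Z"
    by (rule chargingI) (use D assms(2) in blast)+
  then show ?thesis unfolding charged_def by blast
qed

text \<open>D is the part of the stream read so far, A the set of elements that were ever in the
  solution, R the incremental value removed. What lies in D - (B \<union> A) was rejected on arrival
  or dropped from the buffer later. The bound on f A reflects that an element gains no more when
  added to A than to S, and that this gain exceeds the gain of the swap by at most the removed
  value.\<close>

definition invariant ::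
  "real \<Rightarrow> nat \<Rightarrow> 'a list \<Rightarrow> 'a set \<Rightarrow> 'a list \<times> 'a set \<times> nat \<Rightarrow> 'a set \<Rightarrow> bool" where
  "invariant \<beta> m S0 D st A \<longleftrightarrow> (case st of (S, B, w) \<Rightarrow>
     solution S \<and> set S \<subseteq> A \<and> A \<subseteq> X \<and> D \<subseteq> available \<and> B \<subseteq> D \<and> card B < m \<and>
     (\<forall>x\<in>B. accepts f Ms \<alpha> \<beta> S x) \<and> w \<le> matchoid_rank X Ms + m \<and>
     (\<exists>R\<ge>0. f (set S0) + \<beta> * R \<le> f (set S) \<and> f A \<le> f (set S) + R \<and> charged \<beta> S A (D - (B \<union> A)) R))"

lemma invariant_init:
  assumes "solution S0" "0 < m" shows "invariant \<beta> m S0 {} (S0, {}, 0) (set S0)"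
  using assms solutionD(3) charged_empty by (auto simp: invariant_def intro!: exI[of _ 0])

lemma finite_feasible: "finite (feasible_sets X Ms)"
  by (rule finite_subset[of _ "Pow X"]) (auto simp: feasible_sets_def finite_X)

lemma card_feasible_le: "S \<in> feasible_sets X Ms \<Longrightarrow> card S \<le> matchoid_rank X Ms"
  unfolding matchoid_rank_def using finite_feasible by (intro Max_ge) auto

lemma length_solution_le: "solution S \<Longrightarrow> length S \<le> matchoid_rank X Ms"
  using card_feasible_le[of "set S"] distinct_card[of S] by (auto simp: solution_def)

lemma finite_available: "finite available"
  using finite_X by (rule finite_subset[rotated]) (auto simp: available_def)

lemma rls_step_eq:
  fixes S B x w \<beta>
  defines "B1 \<equiv> (if accepts f Ms \<alpha> \<beta> S x then insert x B else B)"
    and "w1 \<equiv> max w (length S + card (insert x B))"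
  shows "rls_step f Ms \<alpha> \<beta> m x (S, B, w) =
    (if card B1 = m then map_pmf (\<lambda>y. (swap S y, {x' \<in> B1 - {y}. accepts f Ms \<alpha> \<beta> (swap S y) x'}, w1)) (pmf_of_set B1)
     else return_pmf (S, B1, w1))"
  unfolding rls_step_def Let_def prod.case swap_def map_pmf_def B1_def w1_def by (rule refl)

lemma rls_step_support:
  fixes S B x w \<beta>
  defines "B1 \<equiv> (if accepts f Ms \<alpha> \<beta> S x then insert x B else B)"
    and "w1 \<equiv> max w (length S + card (insert x B))"
  assumes "st' \<in> set_pmf (rls_step f Ms \<alpha> \<beta> m x (S, B, w))" "0 < m"
  shows "card B1 \<noteq> m \<and> st' = (S, B1, w1) \<or>
    card B1 = m \<and> (\<exists>y\<in>B1. st' = (swap S y, {x' \<in> B1 - {y}. accepts f Ms \<alpha> \<beta> (swap S y) x'}, w1))"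
proof (cases "card B1 = m")
  case True
  then have "finite B1" "B1 \<noteq> {}" using \<open>0 < m\<close> by (auto simp: card_gt_0_iff)
  then show ?thesis
    using True assms(3) unfolding rls_step_eq B1_def[symmetric] w1_def[symmetric] by auto
next
  case False
  then show ?thesis
    using assms(3) unfolding rls_step_eq B1_def[symmetric] w1_def[symmetric] by simp
qed

lemma finite_rls_step:
  assumes "0 < m" shows "finite (set_pmf (rls_step f Ms \<alpha> \<beta> m x st))"
proof -
  obtain S B w where st: "st = (S, B, w)" by (cases st) auto
  define B1 where "B1 = (if accepts f Ms \<alpha> \<beta> S x then insert x B else B)"
  have "finite B1 \<and> B1 \<noteq> {}" if "card B1 = m" using that \<open>0 < m\<close> by (auto simp: card_gt_0_iff)
  then show ?thesis unfolding st rls_step_eq B1_def[symmetric] by simp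
qed

lemma invariant_step:
  assumes inv: "invariant \<beta> m S0 D (S, B, w) A" and x: "x \<in> available" and "0 < m" "0 \<le> \<beta>"
    and st': "st' \<in> set_pmf (rls_step f Ms \<alpha> \<beta> m x (S, B, w))"
  shows "invariant \<beta> m S0 (insert x D) st' (A \<union> set (fst st'))"
proof -
  define B1 where "B1 = (if accepts f Ms \<alpha> \<beta> S x then insert x B else B)"
  define w1 where "w1 = max w (length S + card (insert x B))"
  let ?D = "insert x D"
  obtain R where S: "solution S" "set S \<subseteq> A" "A \<subseteq> X" "D \<subseteq> available" "B \<subseteq> D" "card B < m"
      "\<And>x. x \<in> B \<Longrightarrow> accepts f Ms \<alpha> \<beta> S x" "w \<le> matchoid_rank X Ms + m"
    and R: "0 \<le> R" "f (set S0) + \<beta> * R \<le> f (set S)" "f A \<le> f (set S) + R"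
    and ch: "charged \<beta> S A (D - (B \<union> A)) R"
    using inv by (auto simp: invariant_def)
  have finB: "finite B" using S finite_available by (meson finite_subset)
  have B1: "B1 \<subseteq> ?D" "card B1 \<le> m" "\<And>x. x \<in> B1 \<Longrightarrow> accepts f Ms \<alpha> \<beta> S x" "finite B1"
    using S finB by (auto simp: B1_def card_insert_if split: if_splits)
  have w1: "w1 \<le> matchoid_rank X Ms + m"
    using S length_solution_le[OF S(1)] finB by (auto simp: w1_def card_insert_if)
  have D: "?D \<subseteq> available" "?D \<subseteq> X" using S x by (auto simp: available_def)
  have ch1: "charged \<beta> S A (?D - (B1 \<union> A)) R"
  proof (cases "accepts f Ms \<alpha> \<beta> S x")
    case True
    then show ?thesis by (intro charged_subset[OF ch]) (auto simp: B1_def)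
  next
    case False
    have "charged \<beta> S A ((D - (B \<union> A)) \<union> ({x} - A)) R"
      by (rule charged_reject_set) (use S ch False x \<open>0 \<le> \<beta>\<close> in auto)
    then show ?thesis by (rule charged_subset) (use False in \<open>auto simp: B1_def\<close>)
  qed
  consider "card B1 \<noteq> m" "st' = (S, B1, w1)"
    | y where "card B1 = m" "y \<in> B1" "st' = (swap S y, {x' \<in> B1 - {y}. accepts f Ms \<alpha> \<beta> (swap S y) x'}, w1)"
    using rls_step_support[OF st' \<open>0 < m\<close>] unfolding B1_def[symmetric] w1_def[symmetric] by blast
  then show ?thesis
  proof cases
    case 1
    moreover have "A \<union> set S = A" using S by auto
    ultimately show ?thesis using S B1 w1 D R ch1 by (auto simp: invariant_def)
  next
    case 2
    let ?S = "swap S y" and ?A = "insert y A" and ?C = "exchange f Ms y S"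
    let ?B = "{x' \<in> B1 - {y}. accepts f Ms \<alpha> \<beta> ?S x'}" and ?R = "R + (\<Sum>c\<in>?C. incr f S c)"
    have y: "y \<in> available" "accepts f Ms \<alpha> \<beta> S y" using B1 D 2 by auto
    have A': "A \<union> set ?S = ?A" using S by (auto simp: set_swap)
    have sol: "solution ?S" by (rule solution_swap[OF S(1) y \<open>0 \<le> \<beta>\<close>])
    have "card ?B < m"
      using 2 B1(4) psubset_card_mono[of B1 ?B] by auto
    moreover have "charged \<beta> ?S ?A (?D - (?B \<union> ?A)) ?R"
    proof -
      have "charged \<beta> ?S ?A (?D - (B1 \<union> A)) ?R"
        by (rule charged_swap[OF ch1 S(1-3) y \<open>0 \<le> \<beta>\<close>]) (use D 2 in auto)
      \<comment> \<open>Elements dropped when the buffer is filtered are rejected by the new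
        solution, so they are charged after the swap.\<close>
      then have "charged \<beta> ?S ?A ((?D - (B1 \<union> A)) \<union> ({x' \<in> B1. \<not> accepts f Ms \<alpha> \<beta> ?S x'} - ?A)) ?R"
      proof (rule charged_reject_set[rotated])
        show "set ?S \<subseteq> ?A" "?A \<subseteq> X" using A' y S by (auto simp: available_def)
        show "x \<in> available \<and> x \<notin> ?A \<and> \<not> accepts f Ms \<alpha> \<beta> ?S x"
          if "x \<in> {x' \<in> B1. \<not> accepts f Ms \<alpha> \<beta> ?S x'} - ?A" for x using that B1(1) D(1) by auto
      qed (use sol B1 \<open>0 \<le> \<beta>\<close> in auto)
      then show ?thesis by (rule charged_subset) auto
    qed
    moreover have "f (set S0) + \<beta> * ?R \<le> f (set ?S)"
      using swap_value(2)[OF S(1) y] R(2) alpha_pos by (simp add: distrib_left)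
    moreover have "f ?A \<le> f (set ?S) + ?R"
    proof (cases "y \<in> A")
      \<comment> \<open>This happens if an element of the initial solution is swapped out before it
        arrives. Then A does not change, and it suffices that the marginal at S is
        nonnegative.\<close>
      case True
      have "0 \<le> (1 + \<beta>) * (\<Sum>c\<in>?C. incr f S c)"
        using \<open>0 \<le> \<beta>\<close> sum_exchange_nonneg[OF S(1) y(1)] by simp
      then have "0 \<le> marginal f y (set S)" using y(2) alpha_pos by (simp add: accepts_def)
      then show ?thesis using R(3) swap_value(1)[OF S(1) y] True by (simp add: insert_absorb)
    next
      case False
      have "marginal f y A \<le> marginal f y (set S)"
        using S y False by (intro marginal_antimono) (auto simp: available_def)
      then show ?thesis using R(3) swap_value(1)[OF S(1) y] by (simp add: marginal_def)
    qed
    moreover have "0 \<le> ?R" using R sum_exchange_nonneg[OF S(1) y(1)] by simp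
    moreover have "set ?S \<subseteq> ?A" "?A \<subseteq> X" "?B \<subseteq> ?D" using A' y S B1(1) by (auto simp: available_def)
    ultimately show ?thesis using sol w1 D(1) A' 2(3) unfolding invariant_def by auto
  qed
qed

text \<open>A depends on the whole history and is not a function of the final state, so its
  distribution is studied in the joint law of state and A. Projection to the state gives back the
  original loop.\<close>

definition tracked_step where
  "tracked_step \<beta> m x sA =
     map_pmf (\<lambda>st'. (st', snd sA \<union> set (fst st'))) (rls_step f Ms \<alpha> \<beta> m x (fst sA))"

primrec tracked_loop where
  "tracked_loop \<beta> m [] sA = return_pmf sA"
| "tracked_loop \<beta> m (x # xs) sA = tracked_step \<beta> m x sA \<bind> tracked_loop \<beta> m xs"

lemma map_fst_tracked_loop: "map_pmf fst (tracked_loop \<beta> m xs sA) = rls_loop f Ms \<alpha> \<beta> m xs (fst sA)"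
proof (induction xs arbitrary: sA)
  case (Cons x xs)
  then show ?case by (simp add: map_bind_pmf tracked_step_def bind_map_pmf o_def)
qed simp

lemma finite_tracked_step: "0 < m \<Longrightarrow> finite (set_pmf (tracked_step \<beta> m x sA))"
  by (simp add: tracked_step_def finite_rls_step)

lemma finite_tracked_loop: "0 < m \<Longrightarrow> finite (set_pmf (tracked_loop \<beta> m xs sA))"
  by (induction xs arbitrary: sA) (auto simp: finite_tracked_step)

lemma tracked_step_invariant:
  assumes "invariant \<beta> m S0 D (fst sA) (snd sA)" "x \<in> available" "0 < m" "0 \<le> \<beta>"
    "sA' \<in> set_pmf (tracked_step \<beta> m x sA)"
  shows "invariant \<beta> m S0 (insert x D) (fst sA') (snd sA')"
proof -
  obtain S B w A where sA: "sA = ((S, B, w), A)" by (metis prod.exhaust)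
  then show ?thesis using assms invariant_step[of \<beta> m S0 D S B w A x] by (auto simp: tracked_step_def)
qed

lemma tracked_loop_invariant:
  assumes "invariant \<beta> m S0 D (fst sA) (snd sA)" "set xs \<subseteq> available" "0 < m" "0 \<le> \<beta>"
    "sA' \<in> set_pmf (tracked_loop \<beta> m xs sA)"
  shows "invariant \<beta> m S0 (D \<union> set xs) (fst sA') (snd sA')"
  using assms
proof (induction xs arbitrary: sA D)
  case (Cons x xs)
  then obtain sA1 where sA1: "sA1 \<in> set_pmf (tracked_step \<beta> m x sA)" "sA' \<in> set_pmf (tracked_loop \<beta> m xs sA1)"
    by auto
  then have "invariant \<beta> m S0 (insert x D) (fst sA1) (snd sA1)"
    using Cons.prems by (intro tracked_step_invariant) auto
  then have "invariant \<beta> m S0 (insert x D \<union> set xs) (fst sA') (snd sA')"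
    using Cons.IH[of "insert x D" sA1] Cons.prems sA1 by auto
  then show ?case by simp
qed simp

text \<open>Every insertion picks a given element with probability at most \<open>1 / m\<close> and increases the
  value of the solution by at least \<open>\<alpha>\<close>, so in expectation this potential does not increase.\<close>

definition potential where
  "potential m e S A = indicator A e - f S / (\<alpha> * real m)"

lemma potential_step:
  assumes inv: "invariant \<beta> m S0 D (fst sA) (snd sA)" and x: "x \<in> available" and "0 < m" "0 \<le> \<beta>"
  shows "measure_pmf.expectation (tracked_step \<beta> m x sA) (\<lambda>((S, B, w), A). potential m e (set S) A)
    \<le> potential m e (set (fst (fst sA))) (snd sA)"
proof -
  obtain S B w A where sA: "sA = ((S, B, w), A)" by (metis prod.exhaust)
  define B1 where "B1 = (if accepts f Ms \<alpha> \<beta> S x then insert x B else B)"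
  have S: "solution S" "set S \<subseteq> A" "D \<subseteq> available" "B \<subseteq> D"
      "\<And>x. x \<in> B \<Longrightarrow> accepts f Ms \<alpha> \<beta> S x"
    using inv by (auto simp: invariant_def sA)
  have B1: "y \<in> available \<and> accepts f Ms \<alpha> \<beta> S y" if "y \<in> B1" for y
    using that S x by (auto simp: B1_def split: if_splits)
  have A: "A \<union> set S = A" using S by auto
  show ?thesis
  proof (cases "card B1 = m")
    case False
    then have "tracked_step \<beta> m x sA = return_pmf ((S, B1, max w (length S + card (insert x B))), A)"
      unfolding tracked_step_def sA fst_conv snd_conv rls_step_eq B1_def[symmetric] by (simp add: A)
    then show ?thesis by (simp add: sA)
  next
    case True
    then have fin: "finite B1" "B1 \<noteq> {}" using \<open>0 < m\<close> by (auto simp: card_gt_0_iff)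
    have "measure_pmf.expectation (tracked_step \<beta> m x sA) (\<lambda>((S, B, w), A). potential m e (set S) A)
      = (\<Sum>y\<in>B1. potential m e (set (swap S y)) (A \<union> set (swap S y))) / real m"
      using True fin
      unfolding tracked_step_def sA fst_conv snd_conv rls_step_eq B1_def[symmetric]
      by (simp add: integral_pmf_of_set)
    \<comment> \<open>At most one of the m equally likely choices of y equals e, while every choice
      raises the value of the solution by at least \<alpha> and so lowers the potential by at least
      1 / m.\<close>
    also have "\<dots> \<le> (\<Sum>y\<in>B1. potential m e (set S) A + (if y = e then 1 else 0) - 1 / real m) / real m"
    proof (intro divide_right_mono sum_mono)
      fix y assume y: "y \<in> B1"
      have "0 \<le> \<beta> * (\<Sum>c\<in>exchange f Ms y S. incr f S c)"
        using sum_exchange_nonneg[OF S(1)] B1[OF y] \<open>0 \<le> \<beta>\<close> by simp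
      then have "f (set S) + \<alpha> \<le> f (set (swap S y))"
        using swap_value(2)[OF S(1), of y \<beta>] B1[OF y] by auto
      then have "(f (set S) + \<alpha>) / (\<alpha> * real m) \<le> f (set (swap S y)) / (\<alpha> * real m)"
        using alpha_pos by (intro divide_right_mono) auto
      moreover have "(f (set S) + \<alpha>) / (\<alpha> * real m) = f (set S) / (\<alpha> * real m) + 1 / real m"
        using alpha_pos by (simp add: add_divide_distrib)
      moreover have "indicator (A \<union> set (swap S y)) e \<le> indicator A e + (if y = e then 1 else (0::real))"
        using S(2) by (auto simp: set_swap indicator_def)
      ultimately show "potential m e (set (swap S y)) (A \<union> set (swap S y))
          \<le> potential m e (set S) A + (if y = e then 1 else 0) - 1 / real m"
        by (simp add: potential_def)
    qed simp
    also have "\<dots> = (real m * potential m e (set S) A + (if e \<in> B1 then 1 else 0) - 1) / real m"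
      using fin True \<open>0 < m\<close> by (simp add: sum.distrib sum_subtractf)
    also have "\<dots> \<le> real m * potential m e (set S) A / real m"
      by (intro divide_right_mono) auto
    also have "\<dots> = potential m e (set S) A" using \<open>0 < m\<close> by simp
    finally show ?thesis by (simp add: sA)
  qed
qed

lemma potential_loop:
  assumes "invariant \<beta> m S0 D (fst sA) (snd sA)" "set xs \<subseteq> available" "0 < m" "0 \<le> \<beta>"
  shows "measure_pmf.expectation (tracked_loop \<beta> m xs sA) (\<lambda>((S, B, w), A). potential m e (set S) A)
    \<le> potential m e (set (fst (fst sA))) (snd sA)"
  using assms
proof (induction xs arbitrary: sA D)
  case Nil
  then show ?case by (simp add: case_prod_unfold)
next
  case (Cons x xs)
  have "measure_pmf.expectation (tracked_loop \<beta> m (x # xs) sA) (\<lambda>((S, B, w), A). potential m e (set S) A)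
      = measure_pmf.expectation (tracked_step \<beta> m x sA) (\<lambda>sA. measure_pmf.expectation
          (tracked_loop \<beta> m xs sA) (\<lambda>((S, B, w), A). potential m e (set S) A))"
    unfolding tracked_loop.simps
    using Cons.prems by (intro expectation_bind finite_tracked_step finite_tracked_loop) auto
  also have "\<dots> \<le> measure_pmf.expectation (tracked_step \<beta> m x sA) (\<lambda>((S, B, w), A). potential m e (set S) A)"
  proof (rule expectation_mono)
    show "finite (set_pmf (tracked_step \<beta> m x sA))" using Cons.prems by (simp add: finite_tracked_step)
    fix sA' assume "sA' \<in> set_pmf (tracked_step \<beta> m x sA)"
    then have "invariant \<beta> m S0 (insert x D) (fst sA') (snd sA')"
      using Cons.prems by (intro tracked_step_invariant[of \<beta> m S0 D sA]) auto
    from Cons.IH[OF this] Cons.prems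
    show "measure_pmf.expectation (tracked_loop \<beta> m xs sA') (\<lambda>((S, B, w), A). potential m e (set S) A)
        \<le> (\<lambda>((S, B, w), A). potential m e (set S) A) sA'"
      by (simp add: case_prod_unfold)
  qed
  also have "\<dots> \<le> potential m e (set (fst (fst sA))) (snd sA)"
    using Cons.prems by (intro potential_step) auto
  finally show ?case .
qed

text \<open>R enters once through f A \<le> f S + R and (1 + \<beta>) (p - 1) times through the
  charging, in total p + \<beta> (p - 1) times. Replacing it by (f S - f S0) / \<beta> yields the
  coefficient p/\<beta> + p - 1 of f S0; with the terms 1 and (1 + \<beta>) p, the coefficient of f
  S becomes p (1 + \<beta>)^2 / \<beta>.\<close>

lemma invariant_bound:
  assumes inv: "invariant \<beta> m S0 D (S, B, w) A" and T: "T \<in> feasible_sets X Ms" "T \<subseteq> D"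
    and "0 < \<beta>" "1 \<le> p"
  shows "f (T \<union> A) + (real p / \<beta> + real p - 1) * f (set S0)
    \<le> f (T \<inter> B) + real p * (1 + \<beta>)\<^sup>2 / \<beta> * f (set S) + real (card T) * \<alpha>"
proof -
  obtain R where S: "solution S" "A \<subseteq> X" "D \<subseteq> available" "B \<subseteq> D"
    and R: "0 \<le> R" "f (set S0) + \<beta> * R \<le> f (set S)" "f A \<le> f (set S) + R"
    and ch: "charged \<beta> S A (D - (B \<union> A)) R"
    using inv by (auto simp: invariant_def)
  let ?J = "T - (B \<union> A)"
  have TX: "T \<subseteq> X" by (rule feasible_subset_X) fact
  then have finT: "finite T" using finite_X finite_subset by blast
  have J: "?J \<in> feasible_sets X Ms" by (rule feasible_subset[OF T(1)]) auto
  have BX: "B \<subseteq> X" using S by (auto simp: available_def)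
  have "f (T \<union> A) - f (A \<union> (T \<inter> B)) \<le> (\<Sum>e\<in>?J. marginal f e (A \<union> (T \<inter> B)))"
  proof -
    have "T \<union> A = (A \<union> (T \<inter> B)) \<union> ?J" by blast
    moreover have "A \<union> (T \<inter> B) \<subseteq> X" "?J \<subseteq> X" using S TX by auto
    ultimately show ?thesis using sum_marginal_ge by metis
  qed
  also have "\<dots> \<le> (\<Sum>e\<in>?J. marginal f e A)"
    using S TX by (intro sum_mono marginal_antimono) auto
  also have "\<dots> \<le> real (card ?J) * \<alpha> + (1 + \<beta>) * (real p * f (set S) + (real p - 1) * R)"
    by (rule charged_bound[OF charged_subset[OF ch] S(1) J]) (use T \<open>0 < \<beta>\<close> in auto)
  also have "real (card ?J) * \<alpha> \<le> real (card T) * \<alpha>"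
    using finT alpha_pos by (intro mult_right_mono) (auto intro: card_mono)
  finally have 1: "f (T \<union> A) \<le> f (A \<union> (T \<inter> B)) + real (card T) * \<alpha>
      + (1 + \<beta>) * (real p * f (set S) + (real p - 1) * R)" by simp
  \<comment> \<open>Elements still in the buffer are not charged; they are split off by
    subadditivity and left to the offline algorithm.\<close>
  have 2: "f (A \<union> (T \<inter> B)) \<le> f (set S) + R + f (T \<inter> B)"
    using subadditive[of A "T \<inter> B"] S(2) R(3) le_infI1[OF TX, of B] by linarith
  have "R \<le> (f (set S) - f (set S0)) / \<beta>"
    using R(2) \<open>0 < \<beta>\<close> by (simp add: field_simps)
  then have "(real p + \<beta> * (real p - 1)) * R \<le> (real p + \<beta> * (real p - 1)) * ((f (set S) - f (set S0)) / \<beta>)"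
    using \<open>0 < \<beta>\<close> \<open>1 \<le> p\<close> by (intro mult_left_mono) auto
  also have "\<dots> = (real p / \<beta> + real p - 1) * (f (set S) - f (set S0))"
    using \<open>0 < \<beta>\<close> by (simp add: field_simps)
  finally have 3: "(real p + \<beta> * (real p - 1)) * R \<le> (real p / \<beta> + real p - 1) * (f (set S) - f (set S0))" .
  have "real p * (1 + \<beta>)\<^sup>2 / \<beta> = 2 * real p + \<beta> * real p + real p / \<beta>"
    using \<open>0 < \<beta>\<close> by (simp add: field_simps power2_eq_square)
  then show ?thesis using 1 2 3 by (simp add: algebra_simps)
qed

end

section \<open>Several passes\<close>

lemma expectation_add_le:
  fixes g h :: "'b \<Rightarrow> real"
  assumes "finite (set_pmf p)" "\<And>x. x \<in> set_pmf p \<Longrightarrow> g x + c \<le> a * h1 x + b * h2 x + d"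
  shows "measure_pmf.expectation p g + c
    \<le> a * measure_pmf.expectation p h1 + b * measure_pmf.expectation p h2 + d"
proof -
  have int: "integrable (measure_pmf p) g'" for g' :: "'b \<Rightarrow> real"
    by (rule integrable_measure_pmf_finite) fact
  have "measure_pmf.expectation p (\<lambda>x. g x + c) \<le> measure_pmf.expectation p (\<lambda>x. a * h1 x + b * h2 x + d)"
    using assms by (rule expectation_mono)
  then show ?thesis using int by simp
qed

locale multipass_search = local_search +
  fixes \<gamma> :: real and off :: "'a set \<Rightarrow> 'a set pmf" and m :: nat and \<sigma> :: "nat \<Rightarrow> 'a list"
    and \<beta> :: "nat \<Rightarrow> real"
  assumes offline: "offline_approx X Ms f \<gamma> off" and gamma_nonneg: "0 \<le> \<gamma>"
    and p_pos: "1 \<le> p" and m_pos: "0 < m"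
    and stream: "\<And>i. set (\<sigma> i) = available" and beta_pos: "\<And>i. 1 \<le> i \<Longrightarrow> 0 < \<beta> i"
begin

lemma off_support: "B \<subseteq> X \<Longrightarrow> S' \<in> set_pmf (off B) \<Longrightarrow> S' \<in> feasible_sets X Ms"
  using offline by (auto simp: offline_approx_def)

lemma finite_off: "B \<subseteq> X \<Longrightarrow> finite (set_pmf (off B))"
  using off_support finite_feasible by (meson finite_subset subsetI)

lemma off_bound:
  "B \<subseteq> X \<Longrightarrow> T \<in> feasible_sets X Ms \<Longrightarrow> T \<subseteq> B \<Longrightarrow> f T \<le> \<gamma> * measure_pmf.expectation (off B) f"
  using offline by (auto simp: offline_approx_def)

definition tracked_pass where
  "tracked_pass i S0 = tracked_loop (\<beta> i) m (\<sigma> i) ((S0, {}, 0), set S0)"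

abbreviation pass where
  "pass i S0 \<equiv> randomized_local_search f Ms off S0 \<alpha> (\<beta> i) m (\<sigma> i)"

definition finish where
  "finish = (\<lambda>((S, B, w), A :: 'a set). map_pmf (\<lambda>S'. (S :: 'a list, S', max w (length S + card B + card S'))) (off B))"

lemma pass_eq: "pass i S0 = tracked_pass i S0 \<bind> finish"
proof -
  have "rls_loop f Ms \<alpha> (\<beta> i) m (\<sigma> i) (S0, {}, 0) = map_pmf fst (tracked_pass i S0)"
    by (simp add: tracked_pass_def map_fst_tracked_loop)
  then show ?thesis
    unfolding randomized_local_search_def
    by (simp add: finish_def map_pmf_def case_prod_unfold bind_assoc_pmf bind_return_pmf)
qed

lemma finite_tracked_pass: "finite (set_pmf (tracked_pass i S0))"
  by (simp add: tracked_pass_def finite_tracked_loop m_pos)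

context
  fixes i :: nat and S0 :: "'a list" assumes i: "1 \<le> i" and S0: "solution S0"
begin

lemma tracked_pass_invariant:
  assumes "sA \<in> set_pmf (tracked_pass i S0)"
  shows "invariant (\<beta> i) m S0 available (fst sA) (snd sA)"
proof -
  have "invariant (\<beta> i) m S0 ({} \<union> set (\<sigma> i)) (fst sA) (snd sA)"
    using assms beta_pos[OF i] unfolding tracked_pass_def
    by (intro tracked_loop_invariant) (auto simp: invariant_init S0 m_pos stream)
  then show ?thesis by (simp add: stream)
qed

lemma tracked_passD:
  assumes "((S, B, w), A) \<in> set_pmf (tracked_pass i S0)"
  shows "solution S" "B \<subseteq> X" "A \<subseteq> X" "set S \<subseteq> A" "card B < m" "w \<le> matchoid_rank X Ms + m"
  using tracked_pass_invariant[OF assms] by (auto simp: invariant_def available_def)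

lemma finite_finish:
  assumes "sA \<in> set_pmf (tracked_pass i S0)" shows "finite (set_pmf (finish sA))"
proof -
  obtain S B w A where sA: "sA = ((S, B, w), A)" by (metis prod.exhaust)
  then show ?thesis using tracked_passD(2) assms finite_off by (auto simp: finish_def)
qed

lemma finite_pass: "finite (set_pmf (pass i S0))"
  unfolding pass_eq by (simp add: finite_tracked_pass finite_finish)

lemma pass_support:
  assumes "(S, S', w) \<in> set_pmf (pass i S0)"
  shows "solution S" "S' \<in> feasible_sets X Ms" "w \<le> 2 * matchoid_rank X Ms + m"
proof -
  obtain B w' A where *: "((S, B, w'), A) \<in> set_pmf (tracked_pass i S0)" "S' \<in> set_pmf (off B)"
      "w = max w' (length S + card B + card S')"
    using assms unfolding pass_eq by (auto simp: finish_def)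
  note D = tracked_passD[OF *(1)]
  show "solution S" by (rule D)
  show S': "S' \<in> feasible_sets X Ms" using off_support D(2) *(2) .
  show "w \<le> 2 * matchoid_rank X Ms + m"
    using *(3) D(5,6) length_solution_le[OF D(1)] card_feasible_le[OF S'] by simp
qed

lemma expectation_pass:
  fixes h :: "_ \<Rightarrow> real"
  shows "measure_pmf.expectation (pass i S0) h
    = measure_pmf.expectation (tracked_pass i S0) (\<lambda>sA. measure_pmf.expectation (finish sA) h)"
  unfolding pass_eq by (intro expectation_bind finite_tracked_pass finite_finish)

lemma pass_value:
  assumes T: "T \<in> feasible_sets X Ms"
  shows "measure_pmf.expectation (tracked_pass i S0) (\<lambda>sA. f (T \<union> snd sA))
      + (real p / \<beta> i + real p - 1) * f (set S0)
    \<le> \<gamma> * measure_pmf.expectation (pass i S0) (\<lambda>(S, S', w). f S')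
      + real p * (1 + \<beta> i)\<^sup>2 / \<beta> i * measure_pmf.expectation (pass i S0) (\<lambda>(S, S', w). f (set S))
      + real (card T) * \<alpha>"
  unfolding expectation_pass
proof (intro expectation_add_le finite_tracked_pass)
  fix sA assume sA: "sA \<in> set_pmf (tracked_pass i S0)"
  obtain S B w A where eq: "sA = ((S, B, w), A)" by (metis prod.exhaust)
  note D = tracked_passD[OF sA[unfolded eq]]
  have "f (T \<inter> B) \<le> \<gamma> * measure_pmf.expectation (off B) f"
    by (intro off_bound D feasible_subset[OF T]) auto
  moreover have "f (T \<union> A) + (real p / \<beta> i + real p - 1) * f (set S0)
    \<le> f (T \<inter> B) + real p * (1 + \<beta> i)\<^sup>2 / \<beta> i * f (set S) + real (card T) * \<alpha>"
    using tracked_pass_invariant[OF sA] i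
    by (intro invariant_bound[of "\<beta> i" m S0 available S B w])
      (use feasible_available[OF T] p_pos in \<open>auto simp: eq T beta_pos\<close>)
  ultimately show "f (T \<union> snd sA) + (real p / \<beta> i + real p - 1) * f (set S0)
    \<le> \<gamma> * measure_pmf.expectation (finish sA) (\<lambda>(S, S', w). f S')
      + real p * (1 + \<beta> i)\<^sup>2 / \<beta> i * measure_pmf.expectation (finish sA) (\<lambda>(S, S', w). f (set S))
      + real (card T) * \<alpha>"
    by (simp add: eq finish_def)
qed

lemma pass_potential:
  "measure_pmf.expectation (tracked_pass i S0) (\<lambda>((S, B, w), A). potential m e (set S) A)
    \<le> potential m e (set S0) (set S0)"
  using potential_loop[of "\<beta> i" m S0 "{}" "((S0, {}, 0), set S0)" "\<sigma> i" e] beta_pos[OF i]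
  by (simp add: tracked_pass_def invariant_init S0 m_pos stream)

text \<open>The next pass restarts A with the final solution of this one, a subset of the present A,
  so the indicator can only drop. This lets the potential be chained over the passes.\<close>

lemma pass_potential':
  "measure_pmf.expectation (pass i S0) (\<lambda>(S, S', w). potential m e (set S) (set S))
    \<le> potential m e (set S0) (set S0)"
proof -
  have "measure_pmf.expectation (pass i S0) (\<lambda>(S, S', w). potential m e (set S) (set S))
      \<le> measure_pmf.expectation (tracked_pass i S0) (\<lambda>((S, B, w), A). potential m e (set S) A)"
    unfolding expectation_pass
  proof (rule expectation_mono[OF finite_tracked_pass])
    fix sA assume sA: "sA \<in> set_pmf (tracked_pass i S0)"
    obtain S B w A where eq: "sA = ((S, B, w), A)" by (metis prod.exhaust)
    have "indicator (set S) e \<le> (indicator A e :: real)"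
      using tracked_passD(4)[OF sA[unfolded eq]] by (auto simp: indicator_def)
    then show "measure_pmf.expectation (finish sA) (\<lambda>(S, S', w). potential m e (set S) (set S))
        \<le> (\<lambda>((S, B, w), A). potential m e (set S) A) sA"
      by (simp add: eq finish_def potential_def)
  qed
  then show ?thesis using pass_potential by (rule order_trans)
qed

end

section \<open>Chaining the passes in expectation\<close>

abbreviation passes where "passes i \<equiv> multipass f Ms off \<alpha> \<beta> m \<sigma> i"

definition combine where
  "combine S' w = (\<lambda>(S1, S1', w1). (S1 :: 'a list, better f S' S1', max w (w1 + card S')))"

lemma passes_Suc: "passes (Suc i) = passes i \<bind> (\<lambda>(S, S', w). map_pmf (combine S' w) (pass (Suc i) S))"
  by (simp add: map_pmf_def combine_def case_prod_unfold)

text \<open>A pass needs at most 2 k + m for the solution, the buffer and the offline output; the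
  best earlier offline solution adds another k.\<close>

lemma passes_support:
  assumes "(S, S', w) \<in> set_pmf (passes i)"
  shows "solution S \<and> S' \<in> feasible_sets X Ms \<and> w \<le> 3 * matchoid_rank X Ms + m"
  using assms
proof (induction i arbitrary: S S' w)
  case 0
  then show ?case by (auto simp: solution_def empty_feasible)
next
  case (Suc i)
  then obtain S0 S0' w0 S1' w1 where *: "(S0, S0', w0) \<in> set_pmf (passes i)"
      "(S, S1', w1) \<in> set_pmf (pass (Suc i) S0)" "S' = better f S0' S1'" "w = max w0 (w1 + card S0')"
    unfolding passes_Suc by (auto simp: combine_def)
  note IH = Suc.IH[OF *(1)]
  have S0: "solution S0" using IH by simp
  show ?case
    using IH pass_support[OF _ S0 *(2)] card_feasible_le[of S0'] *(3,4) by (auto simp: better_def)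
qed

lemma finite_passes: "finite (set_pmf (passes i))"
proof (induction i)
  case (Suc i)
  have "finite (set_pmf (map_pmf (combine S' w) (pass (Suc i) S)))" if "(S, S', w) \<in> set_pmf (passes i)" for S S' w
    using passes_support[OF that] finite_pass[of "Suc i" S] by simp
  then show ?case unfolding passes_Suc using Suc by auto
qed simp

lemma expectation_passes_Suc:
  fixes h :: "_ \<Rightarrow> real"
  shows "measure_pmf.expectation (passes (Suc i)) h
    = measure_pmf.expectation (passes i) (\<lambda>(S, S', w). measure_pmf.expectation (pass (Suc i) S) (\<lambda>r. h (combine S' w r)))"
proof -
  have "finite (set_pmf (map_pmf (combine S' w) (pass (Suc i) S)))" if "(S, S', w) \<in> set_pmf (passes i)" for S S' w
    using passes_support[OF that] finite_pass[of "Suc i" S] by simp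
  then show ?thesis
    unfolding passes_Suc by (subst expectation_bind) (auto simp: finite_passes case_prod_unfold)
qed

lemma passes_potential:
  assumes "e \<in> X"
  shows "measure_pmf.expectation (passes i) (\<lambda>(S, S', w). potential m e (set S) (set S)) \<le> 0"
proof (induction i)
  case 0
  show ?case using nonneg[of "{}"] alpha_pos by (simp add: potential_def)
next
  case (Suc i)
  have "measure_pmf.expectation (passes (Suc i)) (\<lambda>(S, S', w). potential m e (set S) (set S))
     \<le> measure_pmf.expectation (passes i) (\<lambda>(S, S', w). potential m e (set S) (set S))"
    unfolding expectation_passes_Suc
  proof (rule expectation_mono[OF finite_passes])
    fix r assume r: "r \<in> set_pmf (passes i)"
    obtain S S' w where eq: "r = (S, S', w)" by (metis prod.exhaust)
    show "(\<lambda>(S, S', w). measure_pmf.expectation (pass (Suc i) S)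
        (\<lambda>r. (\<lambda>(S, S', w). potential m e (set S) (set S)) (combine S' w r))) r
      \<le> (\<lambda>(S, S', w). potential m e (set S) (set S)) r"
      using pass_potential'[of "Suc i" S e] passes_support[of S S' w i] r
      by (simp add: eq combine_def case_prod_unfold)
  qed
  then show ?case using Suc by linarith
qed

text \<open>A contains the random initial solution of its pass, so the potential is followed from
  the empty start through all earlier passes. It bounds the probability of e \<in> A by the expected
  value of the solution divided by \<alpha> m, and \<open>expectation_random_subset\<close> applies
  with q = M / (\<alpha> m).\<close>

lemma tracked_passes_value:
  assumes T: "T \<in> feasible_sets X Ms" and M: "\<And>S. S \<in> feasible_sets X Ms \<Longrightarrow> f S \<le> M"
  shows "(1 - M / (\<alpha> * real m)) * f T
    \<le> measure_pmf.expectation (passes i) (\<lambda>(S, S', w).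
        measure_pmf.expectation (tracked_pass (Suc i) S) (\<lambda>sA. f (T \<union> snd sA)))"
proof -
  define Q where "Q = passes i \<bind> (\<lambda>(S, S', w). tracked_pass (Suc i) S)"
  have finQ: "finite (set_pmf Q)" by (auto simp: Q_def finite_passes finite_tracked_pass)
  have EQ: "measure_pmf.expectation Q h = measure_pmf.expectation (passes i) (\<lambda>(S, S', w).
        measure_pmf.expectation (tracked_pass (Suc i) S) h)" for h :: "_ \<Rightarrow> real"
    unfolding Q_def by (subst expectation_bind) (auto simp: finite_passes finite_tracked_pass case_prod_unfold)
  have supp: "solution S \<and> A \<subseteq> X" if "((S, B, w), A) \<in> set_pmf Q" for S B w A
  proof -
    obtain S0 S' w' where *: "(S0, S', w') \<in> set_pmf (passes i)" "((S, B, w), A) \<in> set_pmf (tracked_pass (Suc i) S0)"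
      using \<open>((S, B, w), A) \<in> set_pmf Q\<close> by (auto simp: Q_def)
    then have "solution S0" using passes_support by blast
    then show ?thesis using tracked_passD(1,3)[OF _ _ *(2)] by simp
  qed
  have "measure_pmf.prob Q {sA. e \<in> snd sA} \<le> M / (\<alpha> * real m)" if e: "e \<in> X" for e
  proof -
    have "measure_pmf.expectation Q (\<lambda>((S, B, w), A). potential m e (set S) A)
        \<le> measure_pmf.expectation (passes i) (\<lambda>(S, S', w). potential m e (set S) (set S))"
      unfolding EQ
    proof (rule expectation_mono[OF finite_passes])
      fix r assume r: "r \<in> set_pmf (passes i)"
      obtain S S' w where eq: "r = (S, S', w)" by (metis prod.exhaust)
      show "(\<lambda>(S, S', w). measure_pmf.expectation (tracked_pass (Suc i) S) (\<lambda>((S, B, w), A). potential m e (set S) A)) r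
        \<le> (\<lambda>(S, S', w). potential m e (set S) (set S)) r"
        using pass_potential[of "Suc i" S e] passes_support[of S S' w i] r by (simp add: eq)
    qed
    also have "\<dots> \<le> 0" by (rule passes_potential[OF e])
    finally have 1: "measure_pmf.expectation Q (\<lambda>((S, B, w), A). potential m e (set S) A) \<le> 0" .
    have "measure_pmf.expectation Q (\<lambda>sA. indicator {sA. e \<in> snd sA} sA - M / (\<alpha> * real m))
        \<le> measure_pmf.expectation Q (\<lambda>((S, B, w), A). potential m e (set S) A)"
    proof (rule expectation_mono[OF finQ])
      fix sA assume sA: "sA \<in> set_pmf Q"
      obtain S B w A where eq: "sA = ((S, B, w), A)" by (metis prod.exhaust)
      have "f (set S) \<le> M" using supp sA M solutionD(2) unfolding eq by blast
      then have "f (set S) / (\<alpha> * real m) \<le> M / (\<alpha> * real m)"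
        using alpha_pos by (intro divide_right_mono) auto
      then show "indicator {sA. e \<in> snd sA} sA - M / (\<alpha> * real m) \<le> (\<lambda>((S, B, w), A). potential m e (set S) A) sA"
        by (simp add: eq potential_def indicator_def)
    qed
    also have "measure_pmf.expectation Q (\<lambda>sA. indicator {sA. e \<in> snd sA} sA - M / (\<alpha> * real m))
        = measure_pmf.prob Q {sA. e \<in> snd sA} - M / (\<alpha> * real m)"
      by (subst Bochner_Integration.integral_diff) (auto intro!: integrable_measure_pmf_finite finQ)
    finally show ?thesis using 1 by linarith
  qed
  moreover have "0 \<le> M / (\<alpha> * real m)"
    using M[OF empty_feasible] nonneg[of "{}"] alpha_pos by simp
  ultimately have "(1 - M / (\<alpha> * real m)) * f T + 0 * f (T \<union> X)
      \<le> measure_pmf.expectation Q (\<lambda>sA. f (T \<union> (snd sA \<inter> X)))"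
    using feasible_subset_X[OF T] by (intro expectation_random_subset finQ) auto
  also have "\<dots> = measure_pmf.expectation Q (\<lambda>sA. f (T \<union> snd sA))"
    using supp by (intro integral_cong_AE) (auto simp: AE_measure_pmf_iff Int_absorb2)
  finally show ?thesis by (simp add: EQ)
qed

lemma passes_value:
  assumes T: "T \<in> feasible_sets X Ms" and M: "\<And>S. S \<in> feasible_sets X Ms \<Longrightarrow> f S \<le> M"
  shows "(1 - M / (\<alpha> * real m)) * f T
      + (real p / \<beta> (Suc i) + real p - 1) * measure_pmf.expectation (passes i) (\<lambda>(S, S', w). f (set S))
    \<le> \<gamma> * measure_pmf.expectation (passes (Suc i)) (\<lambda>(S, S', w). f S')
      + real p * (1 + \<beta> (Suc i))\<^sup>2 / \<beta> (Suc i) * measure_pmf.expectation (passes (Suc i)) (\<lambda>(S, S', w). f (set S))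
      + real (card T) * \<alpha>"
proof -
  let ?c = "real p / \<beta> (Suc i) + real p - 1"
  let ?E = "\<lambda>(S, S' :: 'a set, w :: nat). measure_pmf.expectation (tracked_pass (Suc i) S) (\<lambda>sA. f (T \<union> snd sA))"
  have int: "integrable (measure_pmf (passes i)) g" for g :: "_ \<Rightarrow> real"
    by (rule integrable_measure_pmf_finite) (rule finite_passes)
  have "measure_pmf.expectation (passes i) ?E + ?c * measure_pmf.expectation (passes i) (\<lambda>(S, S', w). f (set S))
      = measure_pmf.expectation (passes i) (\<lambda>r. ?E r + ?c * f (set (fst r))) + 0"
    using int by (simp add: case_prod_unfold)
  also have "\<dots> \<le> \<gamma> * measure_pmf.expectation (passes (Suc i)) (\<lambda>(S, S', w). f S')
      + real p * (1 + \<beta> (Suc i))\<^sup>2 / \<beta> (Suc i) * measure_pmf.expectation (passes (Suc i)) (\<lambda>(S, S', w). f (set S))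
      + real (card T) * \<alpha>"
    unfolding expectation_passes_Suc
  proof (rule expectation_add_le[OF finite_passes])
    fix r assume r: "r \<in> set_pmf (passes i)"
    obtain S S' w where eq: "r = (S, S', w)" by (metis prod.exhaust)
    have S: "solution S" using passes_support r unfolding eq by blast
    have "measure_pmf.expectation (pass (Suc i) S) (\<lambda>(S1, S1', w1). f S1')
      \<le> measure_pmf.expectation (pass (Suc i) S) (\<lambda>(S1, S1', w1). f (better f S' S1'))"
      by (rule expectation_mono[OF finite_pass[OF _ S]]) (auto simp: better_def)
    then have "\<gamma> * measure_pmf.expectation (pass (Suc i) S) (\<lambda>(S1, S1', w1). f S1')
      \<le> \<gamma> * measure_pmf.expectation (pass (Suc i) S) (\<lambda>(S1, S1', w1). f (better f S' S1'))"
      using gamma_nonneg by (rule mult_left_mono)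
    then show "?E r + ?c * f (set (fst r)) + 0
      \<le> \<gamma> * (\<lambda>(S, S', w). measure_pmf.expectation (pass (Suc i) S) (\<lambda>r. (\<lambda>(S, S', w). f S') (combine S' w r))) r
      + real p * (1 + \<beta> (Suc i))\<^sup>2 / \<beta> (Suc i) *
        (\<lambda>(S, S', w). measure_pmf.expectation (pass (Suc i) S) (\<lambda>r. (\<lambda>(S, S', w). f (set S)) (combine S' w r))) r
      + real (card T) * \<alpha>"
      using pass_value[OF _ S T, of "Suc i"] by (simp add: eq combine_def case_prod_unfold)
  qed
  finally show ?thesis using tracked_passes_value[OF T M, of i] by simp
qed

text \<open>This is what keeping the best offline solution is for: when the bounds of several passes
  are added, the offline terms of earlier passes can be replaced by the current one.\<close>

lemma passes_best_mono:
  "measure_pmf.expectation (passes i) (\<lambda>(S, S', w). f S')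
    \<le> measure_pmf.expectation (passes (Suc i)) (\<lambda>(S, S', w). f S')"
  unfolding expectation_passes_Suc
proof (rule expectation_mono[OF finite_passes])
  fix r assume r: "r \<in> set_pmf (passes i)"
  obtain S S' w where eq: "r = (S, S', w)" by (metis prod.exhaust)
  have S: "solution S" using passes_support r unfolding eq by blast
  have "measure_pmf.expectation (pass (Suc i) S) (\<lambda>r. f S')
      \<le> measure_pmf.expectation (pass (Suc i) S) (\<lambda>(S1, S1', w1). f (better f S' S1'))"
    by (rule expectation_mono[OF finite_pass[OF _ S]]) (auto simp: better_def)
  then show "(\<lambda>(S, S', w). f S') r
     \<le> (\<lambda>(S, S', w). measure_pmf.expectation (pass (Suc i) S) (\<lambda>r. (\<lambda>(S, S', w). f S') (combine S' w r))) r"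
    by (simp add: eq combine_def case_prod_unfold)
qed

end

section \<open>Parameters\<close>

text \<open>With d = \<gamma> - 1 - p one has 4 p (p + d) = (2 p + d)^2 - d^2, so the recursion
  multiplies \<gamma> by 1 - d^2 / (2 p + d)^2. The decrease of the excess over the fixed point is
  thus quadratic in d.\<close>

lemma gamma_seq_excess_Suc:
  fixes p :: nat
  defines "\<delta> \<equiv> \<lambda>i. gamma_seq p i - 1 - real p"
  assumes "1 \<le> p" "1 \<le> i" "0 < \<delta> i"
  shows "\<delta> (Suc i) = \<delta> i - (real p + 1 + \<delta> i) * (\<delta> i)\<^sup>2 / (2 * real p + \<delta> i)\<^sup>2"
proof -
  obtain j where i: "i = Suc j" using assms by (cases i) auto
  define d where "d = \<delta> i"
  have g: "gamma_seq p (Suc j) = real p + 1 + d" by (simp add: d_def \<delta>_def i)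
  have pos: "0 < 2 * real p + d" using assms by (simp add: d_def)
  have "\<delta> (Suc i) = 4 * real p * (real p + 1 + d) * (real p + d) / (2 * real p + d)\<^sup>2 - 1 - real p"
    by (simp add: \<delta>_def i g algebra_simps)
  also have "4 * real p * (real p + 1 + d) * (real p + d)
      = (real p + 1 + d) * (2 * real p + d)\<^sup>2 - (real p + 1 + d) * d\<^sup>2"
    by (simp add: algebra_simps power2_eq_square)
  also have "\<dots> / (2 * real p + d)\<^sup>2 - 1 - real p = d - (real p + 1 + d) * d\<^sup>2 / (2 * real p + d)\<^sup>2"
    using pos by (simp add: diff_divide_distrib)
  finally show ?thesis by (simp add: d_def)
qed

text \<open>The recursion implies d' \<le> d - d^2 / (7 p), which forces decay like 7 p / i. The
  bound d \<le> 3 p is carried along because the constant 7 is derived from it; initially d = 3 p -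
  1.\<close>

lemma gamma_seq_bounds:
  assumes p: "1 \<le> p" and i: "1 \<le> i"
  shows "0 < gamma_seq p i - 1 - real p \<and> gamma_seq p i - 1 - real p \<le> 3 * real p
    \<and> real i * (gamma_seq p i - 1 - real p) \<le> 7 * real p"
  using i
proof (induction i rule: dec_induct)
  case base
  then show ?case using p by simp
next
  case (step i)
  define d where "d = gamma_seq p i - 1 - real p"
  define d' where "d' = gamma_seq p (Suc i) - 1 - real p"
  let ?P = "real p"
  have d: "0 < d" "d \<le> 3 * ?P" "real i * d \<le> 7 * ?P" using step by (auto simp: d_def)
  have P: "1 \<le> ?P" using p by simp
  have d': "d' = d - (?P + 1 + d) * d\<^sup>2 / (2 * ?P + d)\<^sup>2"
    unfolding d_def d'_def using gamma_seq_excess_Suc p step d by (simp add: d_def)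
  have "0 < d'"
  proof -
    have "0 < 4 * ?P * ?P + 3 * ?P * d - d"
    proof -
      have "1 * d \<le> (3 * ?P) * d" using P d(1) by (intro mult_right_mono) linarith+
      moreover have "0 < ?P * ?P" using P by simp
      ultimately show ?thesis by linarith
    qed
    then have "(?P + 1 + d) * d < (2 * ?P + d)\<^sup>2"
      by (simp add: power2_eq_square algebra_simps)
    then have "(?P + 1 + d) * d * d < (2 * ?P + d)\<^sup>2 * d" using d by (intro mult_strict_right_mono) auto
    then have "(?P + 1 + d) * d\<^sup>2 / (2 * ?P + d)\<^sup>2 < d"
      using d P by (simp add: divide_less_eq power2_eq_square mult_ac)
    then show ?thesis by (simp add: d')
  qed
  have "d\<^sup>2 / (7 * ?P) \<le> (?P + 1 + d) * d\<^sup>2 / (2 * ?P + d)\<^sup>2"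
  proof -
    have "0 \<le> d * (3 * ?P - d)" "0 \<le> ?P * ?P" using d by simp_all
    moreover have "7 * ?P * (?P + 1 + d) - (2 * ?P + d)\<^sup>2 = 3 * (?P * ?P) + d * (3 * ?P - d) + 7 * ?P"
      by (simp add: power2_eq_square algebra_simps)
    ultimately have "(2 * ?P + d)\<^sup>2 \<le> 7 * ?P * (?P + 1 + d)" using P by linarith
    then have "d\<^sup>2 * (2 * ?P + d)\<^sup>2 \<le> d\<^sup>2 * (7 * ?P * (?P + 1 + d))" by (rule mult_left_mono) simp
    then show ?thesis using d P by (simp add: frac_le_eq divide_le_eq field_simps)
  qed
  then have le: "d' \<le> d - d\<^sup>2 / (7 * ?P)" by (simp add: d')
  \<comment> \<open>After scaling d' to u', the recursion gives u' (1 + u) \<le> u (1 - u^2) \<le>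
    u, while i u \<le> 1 gives (i + 1) u \<le> 1 + u; together (i + 1) u' \<le> 1.\<close>
  define u where "u = d / (7 * ?P)"
  have u: "0 < u" "d = 7 * ?P * u" "real i * u \<le> 1" using d P by (auto simp: u_def field_simps)
  have "d' * (1 + u) \<le> (d - d\<^sup>2 / (7 * ?P)) * (1 + u)" using le u by (intro mult_right_mono) auto
  also have "\<dots> = 7 * ?P * u * (1 - u\<^sup>2)" using P by (simp add: u(2) power2_eq_square field_simps)
  also have "\<dots> \<le> 7 * ?P * u * 1" using u P by (intro mult_left_mono) auto
  finally have "real (Suc i) * (d' * (1 + u)) \<le> real (Suc i) * (7 * ?P * u)" by (intro mult_left_mono) auto
  also have "\<dots> = 7 * ?P * (real i * u + u)" by (simp add: algebra_simps)
  also have "\<dots> \<le> 7 * ?P * (1 + u)" using u by (intro mult_left_mono) auto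
  finally have "real (Suc i) * d' * (1 + u) \<le> 7 * ?P * (1 + u)" by (simp only: mult.assoc)
  then have "real (Suc i) * d' \<le> 7 * ?P" using u(1) by (simp add: mult_le_cancel_right)
  moreover have "d' \<le> 3 * ?P" using le d P by (smt (verit) divide_nonneg_nonneg zero_le_power2)
  ultimately show ?case using \<open>0 < d'\<close> by (simp add: d'_def)
qed

lemma beta_seq_pos: "1 \<le> p \<Longrightarrow> 1 \<le> i \<Longrightarrow> 0 < beta_seq p i"
proof (cases "i = 1")
  case False
  assume "1 \<le> p" "1 \<le> i"
  then have "0 < gamma_seq p (i - 1) - 1 - real p" using gamma_seq_bounds[of p "i - 1"] False by simp
  then show ?thesis using False by (simp add: beta_seq_def)
qed (simp add: beta_seq_def)

text \<open>The left side is the factor of the new solution in the bound for one pass. On the right,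
  the first factor is the total weight when the earlier bound is added with weight \<theta>;
  dividing by it leaves exactly the next \<gamma>.\<close>

lemma gamma_seq_recombine:
  assumes p: "1 \<le> p" and i: "1 \<le> i"
  defines "\<beta> \<equiv> beta_seq p (Suc i)"
  shows "real p * (1 + \<beta>)\<^sup>2 / \<beta> = (1 + (real p / \<beta> + real p - 1) / gamma_seq p i) * gamma_seq p (Suc i)"
proof -
  define d where "d = gamma_seq p i - 1 - real p"
  obtain j where j: "i = Suc j" using i by (cases i) auto
  have d: "0 < d" "gamma_seq p i = real p + 1 + d" using gamma_seq_bounds[OF p i] by (auto simp: d_def)
  have b: "\<beta> = d / (2 * real p + d)" using i d by (simp add: \<beta>_def beta_seq_def algebra_simps)
  have g: "gamma_seq p (Suc i) = 4 * real p * (real p + 1 + d) * (real p + d) / (2 * real p + d)\<^sup>2"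
    using d(2) by (simp add: j algebra_simps)
  define s where "s = 2 * real p + d"
  have s: "s > 0" "real p + 1 + d > 0" using d(1) by (auto simp: s_def)
  have lhs: "1 + (real p / \<beta> + real p - 1) / gamma_seq p i = s * (real p + d) / (d * (real p + 1 + d))"
    unfolding b d(2) s_def[symmetric] using d(1) s
    by (simp add: divide_simps) (simp add: s_def algebra_simps)
  have rhs: "real p * (1 + \<beta>)\<^sup>2 / \<beta> = 4 * real p * (real p + d)\<^sup>2 / (s * d)"
  proof -
    have "1 + \<beta> = 2 * (real p + d) / s" unfolding b s_def[symmetric] using s by (simp add: divide_simps) (simp add: s_def)
    then show ?thesis unfolding b s_def[symmetric] using s d(1)
      by (simp add: power2_eq_square divide_simps) (simp add: algebra_simps)
  qed
  show ?thesis
    unfolding lhs rhs g s_def[symmetric] using s d(1) by (simp add: power2_eq_square divide_simps)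
qed

locale paper_parameters = multipass_search X f Ms p \<alpha> \<gamma> off m \<sigma> "beta_seq p"
  for X :: "'a set" and f Ms p \<alpha> \<gamma> off m \<sigma>
begin

lemma passes_gamma:
  assumes T: "T \<in> feasible_sets X Ms" and M: "\<And>S. S \<in> feasible_sets X Ms \<Longrightarrow> f S \<le> M" and "1 \<le> i"
  shows "(1 - M / (\<alpha> * real m)) * f T
    \<le> gamma_seq p i * measure_pmf.expectation (passes i) (\<lambda>(S, S', w). f (set S))
      + \<gamma> * measure_pmf.expectation (passes i) (\<lambda>(S, S', w). f S') + real (card T) * \<alpha>"
  using \<open>1 \<le> i\<close>
proof (induction i rule: dec_induct)
  case base
  \<comment> \<open>The first pass starts from the empty solution, whose nonnegative term is
    dropped.\<close>
  have "0 \<le> (real p / beta_seq p (Suc 0) + real p - 1) * f {}"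
    using p_pos nonneg[of "{}"] by (intro mult_nonneg_nonneg) (auto simp: beta_seq_def)
  moreover have a0: "measure_pmf.expectation (passes 0) (\<lambda>(S, S', w). f (set S)) = f {}" by simp
  moreover have \<kappa>: "real p * (1 + beta_seq p (Suc 0))\<^sup>2 / beta_seq p (Suc 0) = gamma_seq p (Suc 0)"
    by (simp add: beta_seq_def)
  have "(1 - M / (\<alpha> * real m)) * f T
      + (real p / beta_seq p (Suc 0) + real p - 1) * measure_pmf.expectation (passes 0) (\<lambda>(S, S', w). f (set S))
    \<le> \<gamma> * measure_pmf.expectation (passes (Suc 0)) (\<lambda>(S, S', w). f S')
      + real p * (1 + beta_seq p (Suc 0))\<^sup>2 / beta_seq p (Suc 0) *
        measure_pmf.expectation (passes (Suc 0)) (\<lambda>(S, S', w). f (set S))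
      + real (card T) * \<alpha>" by (rule passes_value[OF T M])
  note V = this[unfolded a0 \<kappa>]
  ultimately show ?case unfolding One_nat_def using V by linarith
next
  case (step i)
  let ?q = "1 - M / (\<alpha> * real m)"
  define a where "a j = measure_pmf.expectation (passes j) (\<lambda>(S, S', w). f (set S))" for j
  define b where "b j = measure_pmf.expectation (passes j) (\<lambda>(S, S', w). f S')" for j
  define c where "c = real p / beta_seq p (Suc i) + real p - 1"
  \<comment> \<open>With this weight the term \<open>c * a i\<close> of the new pass cancels against
    \<theta> times the induction hypothesis.\<close>
  define \<theta> where "\<theta> = c / gamma_seq p i"
  have IH: "?q * f T \<le> gamma_seq p i * a i + \<gamma> * b i + real (card T) * \<alpha>"
    using step.IH unfolding a_def b_def .
  have V: "?q * f T + c * a i \<le> \<gamma> * b (Suc i)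
      + real p * (1 + beta_seq p (Suc i))\<^sup>2 / beta_seq p (Suc i) * a (Suc i) + real (card T) * \<alpha>"
    unfolding a_def b_def c_def by (rule passes_value[OF T M])
  have g: "0 < gamma_seq p i" using gamma_seq_bounds[OF p_pos step.hyps(1)] by simp
  have "0 < real p / beta_seq p (Suc i)" using beta_seq_pos[of p "Suc i"] p_pos by simp
  then have "0 \<le> c" using p_pos unfolding c_def by linarith
  then have \<theta>: "0 \<le> \<theta>" "c = \<theta> * gamma_seq p i" using g by (simp_all add: \<theta>_def)
  have "\<theta> * (?q * f T) \<le> \<theta> * (gamma_seq p i * a i + \<gamma> * b i + real (card T) * \<alpha>)"
    by (rule mult_left_mono[OF IH \<theta>(1)])
  also have "\<dots> = c * a i + \<theta> * (\<gamma> * b i + real (card T) * \<alpha>)" by (simp add: \<theta>(2) algebra_simps)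
  also have "\<dots> \<le> c * a i + \<theta> * (\<gamma> * b (Suc i) + real (card T) * \<alpha>)"
    unfolding b_def
    by (intro add_left_mono mult_left_mono add_right_mono passes_best_mono gamma_nonneg \<theta>(1))
  finally have "\<theta> * (?q * f T) \<le> c * a i + \<theta> * (\<gamma> * b (Suc i) + real (card T) * \<alpha>)" .
  moreover have "?q * f T + c * a i \<le> \<gamma> * b (Suc i) + (1 + \<theta>) * gamma_seq p (Suc i) * a (Suc i) + real (card T) * \<alpha>"
    using V unfolding gamma_seq_recombine[OF p_pos step.hyps(1)] \<theta>_def c_def .
  moreover have "(1 + \<theta>) * (?q * f T) = \<theta> * (?q * f T) + ?q * f T"
    "(1 + \<theta>) * (gamma_seq p (Suc i) * a (Suc i) + \<gamma> * b (Suc i) + real (card T) * \<alpha>)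
      = (1 + \<theta>) * gamma_seq p (Suc i) * a (Suc i) + \<gamma> * b (Suc i) + real (card T) * \<alpha>
        + \<theta> * (\<gamma> * b (Suc i) + real (card T) * \<alpha>)"
    by (simp_all only: distrib_left distrib_right mult_1_left ac_simps)
  ultimately have "(1 + \<theta>) * (?q * f T)
      \<le> (1 + \<theta>) * (gamma_seq p (Suc i) * a (Suc i) + \<gamma> * b (Suc i) + real (card T) * \<alpha>)"
    by linarith
  then have "?q * f T \<le> gamma_seq p (Suc i) * a (Suc i) + \<gamma> * b (Suc i) + real (card T) * \<alpha>"
    by (rule mult_left_le_imp_le) (use \<theta>(1) in linarith)
  then show ?case unfolding a_def b_def .
qed

abbreviation run where
  "run d \<equiv> multipass_randomized_local_search f Ms off \<alpha> (beta_seq p) m \<sigma> d"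

lemma finite_run: "finite (set_pmf (run d))"
  by (simp add: multipass_randomized_local_search_def finite_passes)

lemma run_support:
  "(S, w) \<in> set_pmf (run d) \<Longrightarrow> S \<in> feasible_sets X Ms \<and> w \<le> 3 * matchoid_rank X Ms + m"
  using passes_support by (fastforce simp: multipass_randomized_local_search_def better_def solution_def)

lemma run_value:
  assumes T: "T \<in> feasible_sets X Ms" and M: "\<And>S. S \<in> feasible_sets X Ms \<Longrightarrow> f S \<le> M" and "1 \<le> d"
  shows "(1 - M / (\<alpha> * real m)) * f T
    \<le> (gamma_seq p d + \<gamma>) * measure_pmf.expectation (run d) (\<lambda>(S, w). f S) + real (card T) * \<alpha>"
proof -
  let ?E = "measure_pmf.expectation (run d) (\<lambda>(S, w). f S)"
  have E: "?E = measure_pmf.expectation (passes d) (\<lambda>(S, S', w). f (better f (set S) S'))"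
    by (simp add: multipass_randomized_local_search_def case_prod_unfold)
  have a: "measure_pmf.expectation (passes d) (\<lambda>(S, S', w). f (set S)) \<le> ?E"
    and b: "measure_pmf.expectation (passes d) (\<lambda>(S, S', w). f S') \<le> ?E"
    unfolding E by (intro expectation_mono finite_passes; auto simp: better_def)+
  have "0 \<le> gamma_seq p d" using gamma_seq_bounds[OF p_pos \<open>1 \<le> d\<close>] by simp
  then have "gamma_seq p d * measure_pmf.expectation (passes d) (\<lambda>(S, S', w). f (set S)) \<le> gamma_seq p d * ?E"
    by (intro mult_left_mono a)
  moreover have "\<gamma> * measure_pmf.expectation (passes d) (\<lambda>(S, S', w). f S') \<le> \<gamma> * ?E"
    using gamma_nonneg by (intro mult_left_mono b)
  ultimately show ?thesis using passes_gamma[OF T M \<open>1 \<le> d\<close>] by (simp add: distrib_right)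
qed

end

section \<open>Parallel copies and the guess of the optimum\<close>

lemma best_of_copies_support:
  assumes "(A, w) \<in> set_pmf (best_of_copies f run ls)" "{} \<in> F"
    and "\<And>l A w. l \<in> set ls \<Longrightarrow> (A, w) \<in> set_pmf (run l) \<Longrightarrow> A \<in> F \<and> w \<le> W"
  shows "A \<in> F \<and> w \<le> length ls * W"
  using assms
proof (induction ls arbitrary: A w)
  case (Cons l ls)
  then obtain A1 w1 A2 w2 where *: "(A1, w1) \<in> set_pmf (run l)" "(A2, w2) \<in> set_pmf (best_of_copies f run ls)"
      "A = better f A1 A2" "w = w1 + w2"
    by (auto simp: case_prod_unfold)
  have "A2 \<in> F \<and> w2 \<le> length ls * W" by (rule Cons.IH[OF *(2)]) (use Cons.prems in auto)
  moreover have "A1 \<in> F \<and> w1 \<le> W" by (rule Cons.prems(3)[OF _ *(1)]) simp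
  ultimately show ?case using *(3,4) by (auto simp: better_def)
qed simp

lemma finite_best_of_copies:
  "(\<And>l. l \<in> set ls \<Longrightarrow> finite (set_pmf (run l))) \<Longrightarrow> finite (set_pmf (best_of_copies f run ls))"
  by (induction ls) (auto simp: case_prod_unfold)

text \<open>Taking the better of two outputs lowers the expectation of neither, so a single good
  guess is enough.\<close>

lemma best_of_copies_ge:
  assumes "\<And>l. l \<in> set ls \<Longrightarrow> finite (set_pmf (run l))" "l \<in> set ls"
  shows "measure_pmf.expectation (run l) (\<lambda>(S, w). f S)
    \<le> measure_pmf.expectation (best_of_copies f run ls) (\<lambda>(S, w). f S)"
  using assms
proof (induction ls)
  case (Cons l' ls)
  let ?Q = "best_of_copies f run ls"
  have fin: "finite (set_pmf (run l'))" "finite (set_pmf ?Q)"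
    using Cons.prems by (auto intro: finite_best_of_copies)
  have E: "measure_pmf.expectation (best_of_copies f run (l' # ls)) (\<lambda>(S, w). f S)
    = measure_pmf.expectation (run l') (\<lambda>r. measure_pmf.expectation ?Q (\<lambda>r'. f (better f (fst r) (fst r'))))"
    using fin by (simp add: case_prod_unfold expectation_bind)
  show ?case
  proof (cases "l = l'")
    case True
    have "measure_pmf.expectation (run l') (\<lambda>r. f (fst r))
        \<le> measure_pmf.expectation (run l') (\<lambda>r. measure_pmf.expectation ?Q (\<lambda>r'. f (better f (fst r) (fst r'))))"
    proof (rule expectation_mono[OF fin(1)])
      fix r
      have "measure_pmf.expectation ?Q (\<lambda>r'. f (fst r)) \<le> measure_pmf.expectation ?Q (\<lambda>r'. f (better f (fst r) (fst r')))"
        by (rule expectation_mono[OF fin(2)]) (auto simp: better_def)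
      then show "f (fst r) \<le> measure_pmf.expectation ?Q (\<lambda>r'. f (better f (fst r) (fst r')))" by simp
    qed
    then show ?thesis unfolding E True by (simp add: case_prod_unfold)
  next
    case False
    then have "measure_pmf.expectation (run l) (\<lambda>(S, w). f S) \<le> measure_pmf.expectation ?Q (\<lambda>(S, w). f S)"
      using Cons by auto
    also have "\<dots> = measure_pmf.expectation (run l') (\<lambda>r. measure_pmf.expectation ?Q (\<lambda>r'. f (fst r')))"
      by (simp add: case_prod_unfold)
    also have "\<dots> \<le> measure_pmf.expectation (run l') (\<lambda>r. measure_pmf.expectation ?Q (\<lambda>r'. f (better f (fst r) (fst r'))))"
      by (intro expectation_mono fin) (auto simp: better_def)
    finally show ?thesis unfolding E .
  qed
qed simp

text \<open>The exponents lie in an interval of length log k, so there are at most log k + 1 \<le> 2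
  log k of them, by k \<ge> 2.\<close>

lemma guesses_card:
  assumes "0 < \<tau>" "2 \<le> k"
  shows "finite (guesses \<tau> k)" "real (card (guesses \<tau> k)) \<le> 2 * log 2 (real k)"
proof -
  let ?a = "log 2 \<tau>" and ?b = "log 2 (real k * \<tau>)"
  have ab: "?b = ?a + log 2 (real k)" using assms by (simp add: log_mult)
  have k: "1 \<le> log 2 (real k)" using assms by (simp add: le_log_iff)
  have "guesses \<tau> k \<subseteq> (\<lambda>j. 2 powi j) ` {\<lceil>?a\<rceil>..\<lfloor>?b\<rfloor>}"
  proof
    fix l assume "l \<in> guesses \<tau> k"
    then obtain j :: int where j: "l = 2 powi j" "\<tau> \<le> l" "l \<le> real k * \<tau>" by (auto simp: guesses_def)
    have l: "l = 2 powr real_of_int j" using j(1) by (simp add: powr_real_of_int')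
    have "?a \<le> real_of_int j" "real_of_int j \<le> ?b"
      using j(2,3) assms unfolding l by (simp_all add: log_le_iff le_log_iff)
    then show "l \<in> (\<lambda>j. 2 powi j) ` {\<lceil>?a\<rceil>..\<lfloor>?b\<rfloor>}"
      using j(1) by (auto simp: ceiling_le_iff le_floor_iff)
  qed
  note * = this
  then show "finite (guesses \<tau> k)" by (rule finite_subset) simp
  have "card (guesses \<tau> k) \<le> card {\<lceil>?a\<rceil>..\<lfloor>?b\<rfloor>}"
    using * by (rule surj_card_le[rotated]) simp
  then have "card (guesses \<tau> k) \<le> nat (\<lfloor>?b\<rfloor> - \<lceil>?a\<rceil> + 1)" by simp
  moreover have "real (nat (\<lfloor>?b\<rfloor> - \<lceil>?a\<rceil> + 1)) \<le> ?b - ?a + 1"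
    using ab k by linarith
  ultimately show "real (card (guesses \<tau> k)) \<le> 2 * log 2 (real k)" using ab k by linarith
qed

text \<open>The natural guess is the largest power of two up to v, but for v < 2 \<tau> it may lie
  below \<tau>, where no copy is run. Then the smallest power from \<tau> on is taken, which k \<ge>
  2 keeps in range. It may exceed v, but in this case a single element already has at least half of
  the value v.\<close>

lemma good_guess:
  assumes "0 < \<tau>" "2 \<le> k" "\<tau> \<le> v" "v \<le> real k * \<tau>"
  obtains l where "l \<in> guesses \<tau> k" "v / 2 < l" "l \<le> v \<or> l \<le> 2 * \<tau> \<and> v \<le> 2 * \<tau>"
proof (cases "2 * \<tau> \<le> v")
  case True
  define l :: real where "l = 2 powi \<lfloor>log 2 v\<rfloor>"
  have l: "l = 2 powr real_of_int \<lfloor>log 2 v\<rfloor>" by (simp add: l_def powr_real_of_int')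
  have v: "0 < v" using assms by simp
  have "l \<le> 2 powr (log 2 v)" unfolding l by (intro powr_mono) auto
  then have 1: "l \<le> v" using v by simp
  have "v = 2 powr (log 2 v)" using v by simp
  also have "\<dots> < 2 powr (real_of_int \<lfloor>log 2 v\<rfloor> + 1)" by (intro powr_less_mono) linarith+
  also have "\<dots> = 2 * l" by (simp add: l powr_add)
  finally have 2: "v / 2 < l" by simp
  have "l \<in> guesses \<tau> k" using 1 2 True assms by (auto simp: guesses_def l_def)
  then show thesis using that 1 2 by blast
next
  case False
  define l :: real where "l = 2 powi \<lceil>log 2 \<tau>\<rceil>"
  have l: "l = 2 powr real_of_int \<lceil>log 2 \<tau>\<rceil>" by (simp add: l_def powr_real_of_int')
  have "2 powr (log 2 \<tau>) \<le> l" unfolding l by (intro powr_mono) auto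
  then have 1: "\<tau> \<le> l" using assms by simp
  have "l \<le> 2 powr (log 2 \<tau> + 1)" unfolding l by (intro powr_mono) linarith+
  also have "\<dots> = 2 * \<tau>" using assms by (simp add: powr_add)
  finally have 2: "l \<le> 2 * \<tau>" .
  also have "2 * \<tau> \<le> real k * \<tau>" using assms by (intro mult_right_mono) auto
  finally have "l \<in> guesses \<tau> k" using 1 by (auto simp: guesses_def l_def)
  then show thesis using that[of l] 1 2 False by auto
qed

text \<open>The factor 7 is that of \<open>gamma_seq_bounds\<close>; it brings the last \<gamma>
  down to p + 1 + \<epsilon>.\<close>

definition pass_count :: "nat \<Rightarrow> real \<Rightarrow> nat" where
  "pass_count p \<epsilon> = nat \<lceil>7 * real p / \<epsilon>\<rceil>"

lemma pass_count_bounds: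
  assumes "1 \<le> p" "0 < \<epsilon>" "\<epsilon> \<le> real p"
  shows "7 * (real p / \<epsilon>) \<le> real (pass_count p \<epsilon>)" "real (pass_count p \<epsilon>) \<le> 8 * (real p / \<epsilon>)"
    "7 \<le> pass_count p \<epsilon>" "1 \<le> real p / \<epsilon>"
proof -
  show 1: "1 \<le> real p / \<epsilon>" using assms by simp
  show *: "7 * (real p / \<epsilon>) \<le> real (pass_count p \<epsilon>)" unfolding pass_count_def by simp linarith
  show "7 \<le> pass_count p \<epsilon>" using * 1 by linarith
  show "real (pass_count p \<epsilon>) \<le> 8 * (real p / \<epsilon>)"
    unfolding pass_count_def using 1 by simp linarith
qed

text \<open>\<open>opt\<close> and \<open>single\<close> are the guarantees for OPT and for a best
  singleton. With l \<le> 2 v, \<open>opt\<close> loses the fraction 5/4 \<epsilon>/P of v, harmless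
  for \<epsilon>/P \<le> 1/2 but beyond 1 for \<epsilon>/P near 1. For large \<epsilon>/P the lemma
  therefore uses \<open>single\<close> when l > v. There \<epsilon> is comparable to P, so that a
  constant factor in front of P is affordable.\<close>

lemma approximation_arith:
  fixes P \<epsilon> E v \<gamma> G K l \<tau> :: real
  assumes P: "1 \<le> P" "0 < \<epsilon>" "\<epsilon> \<le> P" and E: "0 \<le> E" and v: "0 < v"
    and \<gamma>: "1 \<le> \<gamma>" "\<gamma> \<le> K * P" and G: "G \<le> P + 1 + \<epsilon>"
    and opt: "(1 - \<epsilon> / P / 4) * v \<le> (G + \<gamma>) * E + \<epsilon> / P * l / 2"
    and single: "(1 - \<epsilon> / P / 4) * \<tau> \<le> (G + \<gamma>) * E + \<epsilon> / P * l / 4"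
    and l: "l \<le> 2 * v" "l \<le> v \<or> l \<le> 2 * \<tau> \<and> v \<le> 2 * \<tau>"
  shows "v \<le> (P + 1 + \<gamma> + (36 + 14 * \<bar>K\<bar>) * \<epsilon>) * E"
proof -
  define e where "e = \<epsilon> / P"
  have e: "0 < e" "e \<le> 1" "\<epsilon> = e * P" using P by (auto simp: e_def)
  have "0 < K * P" using \<gamma> by linarith
  then have K: "0 < K" using P by (simp add: zero_less_mult_iff)
  define H where "H = (P + 1 + \<gamma> + \<epsilon>) * E"
  have H: "(G + \<gamma>) * E \<le> H" unfolding H_def using G E by (intro mult_right_mono) auto
  have A: "P + 1 + \<gamma> \<le> (2 + K) * P" using P \<gamma> by (simp add: algebra_simps)
  show ?thesis
  proof (cases "e \<le> 1 / 2")
    case True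
    define x where "x = 5 / 4 * e"
    have x: "0 < x" "x \<le> 5 / 8" using True e by (auto simp: x_def)
    have "e * l / 2 \<le> e * v" using l(1) e by (simp add: mult_left_mono)
    then have "(1 - x) * v \<le> H" using opt H unfolding e_def[symmetric] x_def by (simp add: algebra_simps)
    also have "H \<le> ((1 - x) * (P + 1 + \<gamma> + (36 + 14 * K) * \<epsilon>)) * E"
      unfolding H_def
    proof (rule mult_right_mono[OF _ E])
      have "x * (P + 1 + \<gamma>) \<le> x * ((2 + K) * P)" using A x by (intro mult_left_mono) auto
      also have "\<dots> = (5 / 2 + 5 / 4 * K) * \<epsilon>" by (simp add: x_def e(3) algebra_simps)
      finally have 1: "x * (P + 1 + \<gamma>) \<le> (5 / 2 + 5 / 4 * K) * \<epsilon>" .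
      have "3 / 8 * ((36 + 14 * K) * \<epsilon>) \<le> (1 - x) * ((36 + 14 * K) * \<epsilon>)"
        using x K P by (intro mult_right_mono) auto
      moreover have "0 \<le> K * \<epsilon>" using K P by simp
      ultimately show "P + 1 + \<gamma> + \<epsilon> \<le> (1 - x) * (P + 1 + \<gamma> + (36 + 14 * K) * \<epsilon>)"
        using 1 P by (simp add: algebra_simps)
    qed
    finally have "(1 - x) * v \<le> (1 - x) * ((P + 1 + \<gamma> + (36 + 14 * K) * \<epsilon>) * E)" by (simp only: mult.assoc)
    then show ?thesis using x K by (simp add: mult_le_cancel_left)
  next
    case False
    have "v \<le> 8 * H"
    proof (cases "l \<le> v")
      case True
      have "e * l / 2 \<le> e * v / 2" using True e by (simp add: mult_left_mono)
      then have "(1 - 3 / 4 * e) * v \<le> H" using opt H unfolding e_def[symmetric] by (simp add: algebra_simps)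
      moreover have "1 / 4 * v \<le> (1 - 3 / 4 * e) * v" using e v by (intro mult_right_mono) auto
      ultimately show ?thesis using v by linarith
    next
      case False
      then have l': "l \<le> 2 * \<tau>" "v \<le> 2 * \<tau>" using l(2) by auto
      have "e * l / 4 \<le> e * (2 * \<tau>) / 4" using l' e by (simp add: mult_left_mono)
      then have "(1 - 3 / 4 * e) * \<tau> \<le> H" using single H unfolding e_def[symmetric] by (simp add: algebra_simps)
      moreover have "1 / 4 * \<tau> \<le> (1 - 3 / 4 * e) * \<tau>" using e v l' by (intro mult_right_mono) auto
      ultimately show ?thesis using l' by linarith
    qed
    also have "8 * H = (8 * (P + 1 + \<gamma> + \<epsilon>)) * E" by (simp add: H_def)
    also have "\<dots> \<le> (P + 1 + \<gamma> + (36 + 14 * K) * \<epsilon>) * E"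
    proof (rule mult_right_mono[OF _ E])
      \<comment> \<open>Origin of 36 and 14: 7 (P + 1 + \<gamma>) \<le> 7 (2 + K) P \<le> 14 (2 + K)
        \<epsilon>, and 8 \<epsilon> is added.\<close>
      have "(2 + K) * P \<le> (2 + K) * (2 * \<epsilon>)"
        using False P K by (intro mult_left_mono) (auto simp: e_def field_simps)
      then show "8 * (P + 1 + \<gamma> + \<epsilon>) \<le> P + 1 + \<gamma> + (36 + 14 * K) * \<epsilon>"
        using A by (simp add: algebra_simps)
    qed
    finally show ?thesis using K by simp
  qed
qed

section \<open>From one good copy to the whole algorithm\<close>

context local_search begin

lemma singleton_feasible: "x \<in> available \<Longrightarrow> {x} \<in> feasible_sets X Ms"
  by (auto simp: available_def feasible_sets_def)

lemma max_singleton: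
  assumes k: "2 \<le> matchoid_rank X Ms"
  defines "\<tau> \<equiv> Max ((\<lambda>e. f {e}) ` available)"
  shows "\<exists>e\<in>available. f {e} = \<tau>"
    and "T \<in> feasible_sets X Ms \<Longrightarrow> f T \<le> real (matchoid_rank X Ms) * \<tau>"
proof -
  have "matchoid_rank X Ms \<in> card ` feasible_sets X Ms"
    unfolding matchoid_rank_def using finite_feasible empty_feasible by (intro Max_in) auto
  then obtain K where K: "K \<in> feasible_sets X Ms" "2 \<le> card K" using k by auto
  then obtain a b where ab: "a \<in> K" "b \<in> K" "a \<noteq> b"
    using card_le_Suc0_iff_eq[of K] card.infinite[of K] by fastforce
  then have avail: "a \<in> available" "b \<in> available" using feasible_available[OF K(1)] by auto
  have le: "f {e} \<le> \<tau>" if "e \<in> available" for e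
    unfolding \<tau>_def using finite_available that by (intro Max_ge) auto
  have "\<tau> \<in> (\<lambda>e. f {e}) ` available"
    unfolding \<tau>_def using finite_available avail by (intro Max_in) auto
  then show "\<exists>e\<in>available. f {e} = \<tau>" by auto
  have X: "a \<in> X" "b \<in> X" using avail by (auto simp: available_def)
  have \<tau>0: "0 \<le> \<tau>" using nonneg[of "{a}"] le[OF avail(1)] X by simp
  assume T: "T \<in> feasible_sets X Ms"
  show "f T \<le> real (matchoid_rank X Ms) * \<tau>"
  proof (cases "T = {}")
    case True
    \<comment> \<open>The empty set may have positive value. Two distinct available elements, which
      exist by k \<ge> 2, bound it by 2 \<tau>.\<close>
    have "f T \<le> f {a} + f {b}"
      using submod[of "{a}" "{b}"] nonneg[of "{a} \<union> {b}"] X ab(3) True by simp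
    also have "\<dots> \<le> 2 * \<tau>" using le[OF avail(1)] le[OF avail(2)] by simp
    also have "\<dots> \<le> real (matchoid_rank X Ms) * \<tau>" using k \<tau>0 by (intro mult_right_mono) auto
    finally show ?thesis .
  next
    case False
    have "f T \<le> (\<Sum>e\<in>T. f {e})" by (rule le_sum_singletons[OF False feasible_subset_X[OF T]])
    also have "\<dots> \<le> (\<Sum>e\<in>T. \<tau>)" using feasible_available[OF T] by (intro sum_mono le) auto
    also have "\<dots> = real (card T) * \<tau>" by simp
    also have "\<dots> \<le> real (matchoid_rank X Ms) * \<tau>"
      using card_feasible_le[OF T] \<tau>0 by (intro mult_right_mono) auto
    finally show ?thesis .
  qed
qed

end

lemma streaming_guarantee:
  fixes X :: "'a set"
  assumes p: "1 \<le> p" and ms: "p_matchoid p X Ms" and k: "k = matchoid_rank X Ms" "2 \<le> k"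
    and f: "nonneg_submodular X f" and off: "offline_approx X Ms f \<gamma> off" and \<gamma>: "\<gamma> \<le> K * real p"
    and OPT: "OPT \<in> feasible_sets X Ms" "\<And>T. T \<in> feasible_sets X Ms \<Longrightarrow> f T \<le> f OPT"
    and \<epsilon>: "0 < \<epsilon>" "\<epsilon> \<le> real p" and \<sigma>: "\<And>i. set (\<sigma> i) = X"
  defines "alg \<equiv> streaming_algorithm f Ms off p k \<epsilon> (pass_count p \<epsilon>) \<sigma>"
  shows "(S, w) \<in> set_pmf alg \<Longrightarrow> S \<in> feasible_sets X Ms \<and>
        real w \<le> 72 * (real p ^ 3 * real k * log 2 (real k) / \<epsilon> ^ 3)"
    and "f OPT \<le> (real p + 1 + \<gamma> + (36 + 14 * \<bar>K\<bar>) * \<epsilon>) * measure_pmf.expectation alg (\<lambda>(S, w). f S)"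
proof -
  \<comment> \<open>The value 1 is a placeholder: this instance supplies the facts that do not
    depend on \<alpha>, before any guess is fixed.\<close>
  interpret base: local_search X f Ms p 1
    using ms f by unfold_locales (auto simp: p_matchoid_def)
  define \<sigma>' where "\<sigma>' i = filter (\<lambda>x. satisfies Ms {x}) (\<sigma> i)" for i :: nat
  have \<sigma>': "set (\<sigma>' i) = base.available" for i by (auto simp: \<sigma>'_def \<sigma> base.available_def)
  define \<tau> where "\<tau> = Max ((\<lambda>e. f {e}) ` base.available)"
  define d where "d = pass_count p \<epsilon>"
  define m where "m = nat \<lceil>4 * real d * real k / (\<epsilon> / real p)\<^sup>2\<rceil>"
  define ls where "ls = sorted_list_of_set (guesses \<tau> k)"
  define copy where "copy l = multipass_randomized_local_search f Ms off
      (\<epsilon> / real p * l / (2 * real k)) (beta_seq p) m \<sigma>' d" for l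
  have alg: "alg = best_of_copies f copy ls"
    unfolding alg_def streaming_algorithm_def Let_def \<sigma>'_def[symmetric] \<sigma>' \<tau>_def[symmetric]
      d_def[symmetric] m_def[symmetric] ls_def[symmetric] copy_def[symmetric] by simp
  obtain e0 where e0: "e0 \<in> base.available" "f {e0} = \<tau>"
    using base.max_singleton(1) k unfolding \<tau>_def by blast
  have \<tau>: "\<tau> \<le> f OPT" using OPT(2)[OF base.singleton_feasible[OF e0(1)]] e0(2) by simp
  have opt_le: "f OPT \<le> real k * \<tau>" using base.max_singleton(2)[OF _ OPT(1)] k by (simp add: \<tau>_def)
  have nonneg: "0 \<le> f T" if "T \<in> feasible_sets X Ms" for T
    using base.nonneg base.feasible_subset_X[OF that] .
  have ls: "set ls = guesses \<tau> k" "length ls = card (guesses \<tau> k)" if "0 < \<tau>"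
    using guesses_card(1)[OF that k(2)] by (simp_all add: ls_def)
  have r: "1 \<le> real p / \<epsilon>" and d: "real d \<le> 8 * (real p / \<epsilon>)" "7 \<le> d"
    using pass_count_bounds[OF p \<epsilon>] by (simp_all add: d_def)
  have m_arg: "4 * real d * real k / (\<epsilon> / real p)\<^sup>2 = 4 * real d * real k * (real p / \<epsilon>)\<^sup>2"
    using p \<epsilon> by (simp add: field_simps)
  have m: "4 * real d * real k / (\<epsilon> / real p)\<^sup>2 \<le> real m" "real m \<le> 4 * real d * real k * (real p / \<epsilon>)\<^sup>2 + 1"
    unfolding m_def m_arg by simp_all
  have "0 < 4 * real d * real k / (\<epsilon> / real p)\<^sup>2" using d k p \<epsilon> by simp
  then have m0: "0 < m" using m(1) by linarith
  \<comment> \<open>On the ground set X the offline algorithm cannot beat OPT, so its factor is at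
    least 1.\<close>
  have opt_pos: "0 < \<tau> \<and> 1 \<le> \<gamma>" if pos: "0 < f OPT"
  proof
    show "0 < \<tau>" using opt_le pos k by (smt (verit) mult_nonneg_nonpos of_nat_0_le_iff)
    let ?E = "measure_pmf.expectation (off X) f"
    have supp: "S' \<in> feasible_sets X Ms" if "S' \<in> set_pmf (off X)" for S'
      using off that by (auto simp: offline_approx_def)
    then have fin: "finite (set_pmf (off X))"
      using base.finite_feasible by (meson finite_subset subsetI)
    have "?E \<le> measure_pmf.expectation (off X) (\<lambda>_. f OPT)"
      by (rule expectation_mono[OF fin]) (rule OPT(2)[OF supp])
    then have "?E \<le> f OPT" by simp
    moreover have "measure_pmf.expectation (off X) (\<lambda>_. 0) \<le> ?E"
      by (rule expectation_mono[OF fin]) (rule nonneg[OF supp])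
    then have "0 \<le> ?E" by simp
    moreover have le: "f OPT \<le> \<gamma> * ?E"
      using off OPT(1) base.feasible_subset_X[OF OPT(1)] by (auto simp: offline_approx_def)
    ultimately show "1 \<le> \<gamma>"
    proof -
      assume E: "?E \<le> f OPT" "0 \<le> ?E"
      show ?thesis
      proof (rule ccontr)
        assume "\<not> 1 \<le> \<gamma>"
        then have "\<gamma> * ?E \<le> 1 * ?E" using E by (intro mult_right_mono) auto
        then have "?E = f OPT" using E le by linarith
        then show False using le pos \<open>\<not> 1 \<le> \<gamma>\<close> by (simp add: mult_le_cancel_right1)
      qed
    qed
  qed
  \<comment> \<open>Then \<tau> \<le> f OPT \<le> 0, no power of two lies between \<tau> and k
    \<tau>, and no copy is run.\<close>
  have opt_zero: "alg = return_pmf ({}, 0)" if "\<not> 0 < f OPT"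
  proof -
    have "real k * \<tau> \<le> 0" using that \<tau> by (intro mult_nonneg_nonpos) auto
    moreover have "(0 :: real) < 2 powi j" for j by simp
    ultimately have "guesses \<tau> k = {}" unfolding guesses_def by (smt (verit) Collect_empty_eq)
    then show ?thesis by (simp add: alg ls_def)
  qed
  have params: "paper_parameters X f Ms p (\<epsilon> / real p * l / (2 * real k)) \<gamma> off m \<sigma>'"
    if "0 < f OPT" "l \<in> guesses \<tau> k" for l
  proof -
    have "0 < l" using that(2) by (auto simp: guesses_def)
    then have "0 < \<epsilon> / real p * l / (2 * real k)" using p \<epsilon> k by simp
    then show ?thesis
      using opt_pos[OF that(1)] ms off p m0 \<sigma>' by unfold_locales (auto intro: beta_seq_pos)
  qed
  have copy_support: "S \<in> feasible_sets X Ms \<and> w \<le> 3 * k + m" and copy_finite: "finite (set_pmf (copy l))"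
    if "0 < f OPT" "l \<in> set ls" "(S, w) \<in> set_pmf (copy l)" for l S w
  proof -
    interpret paper_parameters X f Ms p "\<epsilon> / real p * l / (2 * real k)" \<gamma> off m \<sigma>'
      by (rule params) (use that ls opt_pos in auto)
    show "S \<in> feasible_sets X Ms \<and> w \<le> 3 * k + m" using run_support that(3) by (simp add: copy_def k(1))
    show "finite (set_pmf (copy l))" using finite_run by (simp add: copy_def)
  qed
  have alg_feasible: "S \<in> feasible_sets X Ms" and alg_length: "w \<le> length ls * (3 * k + m)"
    if pos: "0 < f OPT" and "(S, w) \<in> set_pmf alg" for S w
    using best_of_copies_support[of S w f copy ls "feasible_sets X Ms" "3 * k + m"]
      that base.empty_feasible copy_support[OF pos] unfolding alg by blast+
  show "S \<in> feasible_sets X Ms \<and> real w \<le> 72 * (real p ^ 3 * real k * log 2 (real k) / \<epsilon> ^ 3)"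
    if "(S, w) \<in> set_pmf alg"
  proof (cases "0 < f OPT")
    case False
    have "0 \<le> log 2 (real k)" using k by simp
    then show ?thesis using that opt_zero[OF False] base.empty_feasible \<epsilon> by simp
  next
    case True
    let ?r = "real p / \<epsilon>"
    have lg: "0 \<le> log 2 (real k)" using k by simp
    have "4 * real d * real k * ?r\<^sup>2 \<le> 4 * (8 * ?r) * real k * ?r\<^sup>2"
      using d by (intro mult_right_mono mult_left_mono) auto
    then have "real m \<le> 32 * real k * ?r ^ 3 + 1" using m(2) by (simp add: power2_eq_square power3_eq_cube mult_ac)
    moreover have "real k * 1 \<le> real k * ?r ^ 3" using one_le_power[OF r, of 3] by (intro mult_left_mono) auto
    \<comment> \<open>36 = 32 + 3 + 1: the buffer, three sets of size at most k, and rounding. The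
      number of copies contributes 2 log k, hence 72.\<close>
    ultimately have "real (3 * k + m) \<le> 36 * (real k * ?r ^ 3)" using k(2) by linarith
    moreover have "real (length ls) \<le> 2 * log 2 (real k)"
      using guesses_card(2)[OF _ k(2)] ls(2) opt_pos[OF True] by simp
    ultimately have "real (length ls) * real (3 * k + m) \<le> (2 * log 2 (real k)) * (36 * (real k * ?r ^ 3))"
      using lg by (intro mult_mono) auto
    moreover have "real w \<le> real (length ls) * real (3 * k + m)"
      using alg_length[OF True that] by (metis of_nat_le_iff of_nat_mult)
    ultimately show ?thesis using alg_feasible[OF True that] by (simp add: power_divide mult_ac)
  qed
  let ?E = "measure_pmf.expectation alg (\<lambda>(S, w). f S)"
  show "f OPT \<le> (real p + 1 + \<gamma> + (36 + 14 * \<bar>K\<bar>) * \<epsilon>) * ?E"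
  proof (cases "0 < f OPT")
    case False
    have "f {} = 0" "f OPT = 0" using False OPT(2)[OF base.empty_feasible] nonneg[OF base.empty_feasible] nonneg[OF OPT(1)] by auto
    then show ?thesis by (simp add: opt_zero[OF False])
  next
    case True
    have \<tau>0: "0 < \<tau>" and \<gamma>1: "1 \<le> \<gamma>" using opt_pos[OF True] by auto
    obtain l where l: "l \<in> guesses \<tau> k" "f OPT / 2 < l" "l \<le> f OPT \<or> l \<le> 2 * \<tau> \<and> f OPT \<le> 2 * \<tau>"
      by (rule good_guess[OF \<tau>0 k(2) \<tau> opt_le])
    let ?e = "\<epsilon> / real p" and ?\<alpha> = "\<epsilon> / real p * l / (2 * real k)"
    interpret paper_parameters X f Ms p ?\<alpha> \<gamma> off m \<sigma>' by (rule params[OF True l(1)])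
    have finr: "finite (set_pmf (copy l'))" if "l' \<in> set ls" for l'
    proof -
      obtain S w where "(S, w) \<in> set_pmf (copy l')" using set_pmf_not_empty[of "copy l'"] by fast
      then show ?thesis using copy_finite[OF True that] by blast
    qed
    let ?E' = "measure_pmf.expectation (copy l) (\<lambda>(S, w). f S)"
    have "l \<in> set ls" using ls(1)[OF \<tau>0] l(1) by simp
    then have E': "?E' \<le> ?E" unfolding alg by (intro best_of_copies_ge finr)
    have "measure_pmf.expectation (copy l) (\<lambda>_. 0) \<le> ?E'"
      by (rule expectation_mono[OF finr[OF \<open>l \<in> set ls\<close>]])
        (use copy_support[OF True \<open>l \<in> set ls\<close>] nonneg in fastforce)
    then have E: "0 \<le> ?E" using E' by simp
    let ?G = "gamma_seq p d"
    have d1: "1 \<le> d" using d by simp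
    note g = gamma_seq_bounds[OF p d1]
    have G: "?G \<le> real p + 1 + \<epsilon>"
    proof -
      have "real d * (?G - 1 - real p) \<le> 7 * real p" using g by simp
      also have "\<dots> = \<epsilon> * (7 * (real p / \<epsilon>))" using \<epsilon> by simp
      also have "\<dots> \<le> \<epsilon> * real d" using pass_count_bounds(1)[OF p \<epsilon>] \<epsilon> by (intro mult_left_mono) (auto simp: d_def)
      finally have "real d * (?G - 1 - real p) \<le> real d * \<epsilon>" by (simp add: mult.commute)
      then show ?thesis using d1 by (simp add: mult_le_cancel_left)
    qed
    have e: "0 < ?e" "?e \<le> 1" using p \<epsilon> by auto
    have l0: "0 < l" using l(2) True by simp
    \<comment> \<open>By the choice of \<alpha> and m, \<alpha> m \<ge> 2 d l / \<epsilon>'. With d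
      \<ge> 4 and l > f OPT / 2 this is at least 4 f OPT / \<epsilon>'.\<close>
    have q: "1 - ?e / 4 \<le> 1 - f OPT / (?\<alpha> * real m)"
    proof -
      have \<alpha>: "0 < ?\<alpha>" using p \<epsilon> l0 k(2) by simp
      have "?\<alpha> * (4 * real d * real k / ?e\<^sup>2) \<le> ?\<alpha> * real m"
        using m(1) \<alpha> by (intro mult_left_mono) auto
      moreover have "?\<alpha> * (4 * real d * real k / ?e\<^sup>2) = 2 * real d * l / ?e"
        using k e by (simp add: power2_eq_square field_simps)
      moreover have "8 * l \<le> 2 * real d * l" using d l0 by (intro mult_right_mono) auto
      then have "4 * f OPT / ?e \<le> 2 * real d * l / ?e" using l(2) e by (intro divide_right_mono) auto
      ultimately have "4 * f OPT / ?e \<le> ?\<alpha> * real m" by linarith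
      moreover have "v / A \<le> e / 4" if "4 * v / e \<le> A" "0 < A" "0 < e" for v A e :: real
        using that by (simp add: field_simps)
      moreover have "0 < ?\<alpha> * real m" using \<alpha> m0 by (intro mult_pos_pos) simp_all
      ultimately show ?thesis using e(1) by fastforce
    qed
    have bound: "(1 - ?e / 4) * f T \<le> (?G + \<gamma>) * ?E + real (card T) * ?\<alpha>" if T: "T \<in> feasible_sets X Ms" for T
    proof -
      have "(1 - ?e / 4) * f T \<le> (1 - f OPT / (?\<alpha> * real m)) * f T"
        using q nonneg[OF T] by (rule mult_right_mono)
      also have "\<dots> \<le> (?G + \<gamma>) * ?E' + real (card T) * ?\<alpha>"
        unfolding copy_def by (rule run_value[OF T OPT(2) d1])
      also have "\<dots> \<le> (?G + \<gamma>) * ?E + real (card T) * ?\<alpha>"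
        using g \<gamma>1 by (intro add_right_mono mult_left_mono[OF E']) linarith
      finally show ?thesis .
    qed
    have \<alpha>0: "0 \<le> ?\<alpha>" by (rule less_imp_le[OF alpha_pos])
    show ?thesis
    proof (rule approximation_arith[OF _ \<epsilon> E True \<gamma>1 \<gamma> G])
      have "real (card OPT) * ?\<alpha> \<le> real k * ?\<alpha>"
        using base.card_feasible_le[OF OPT(1)] \<alpha>0 k(1) by (intro mult_right_mono) auto
      also have "\<dots> = ?e * l / 2" using k(2) by simp
      finally show "(1 - ?e / 4) * f OPT \<le> (?G + \<gamma>) * ?E + ?e * l / 2" using bound[OF OPT(1)] by linarith
      \<comment> \<open>A singleton pays \<alpha> only once, which by k \<ge> 2 is at most
        \<epsilon>' l / 4.\<close>
      have "?\<alpha> \<le> ?e * l / 4" using p \<epsilon> l0 k(2) by (intro divide_left_mono) auto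
      then show "(1 - ?e / 4) * \<tau> \<le> (?G + \<gamma>) * ?E + ?e * l / 4"
        using bound[OF base.singleton_feasible[OF e0(1)]] e0(2) by simp
      show "l \<le> 2 * f OPT" using l(3) \<tau> True by linarith
    qed (use p l(3) in auto)
  qed
qed

text \<open>C depends on K because the factor 1 - O(\<epsilon>/p) in front of f OPT has to be moved
  to the other side, where it affects \<open>\<gamma>_off\<close>; the resulting error of order
  \<open>\<gamma>_off\<close> \<epsilon>/p is O(\<epsilon>) if \<open>\<gamma>_off\<close> \<le> K
  p. The additional pass counted beside d is the one computing \<tau>.\<close>

theorem theorem4:
  shows "\<exists>(d :: nat \<Rightarrow> real \<Rightarrow> nat) (C_pass :: real) (C_mem :: real).
    (\<forall>p \<epsilon>. 1 \<le> p \<and> 0 < \<epsilon> \<and> \<epsilon> \<le> real p \<longrightarrow>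
       1 \<le> d p \<epsilon> \<and> real (d p \<epsilon> + 1) \<le> C_pass * (real p / \<epsilon>)) \<and>
    (\<forall>K :: real. \<exists>C :: real.
       \<forall>(X :: 'a set) Ms p k f \<gamma>_off off OPT \<epsilon> \<sigma>.
         1 \<le> p \<and> p_matchoid p X Ms \<and> k = matchoid_rank X Ms \<and> 2 \<le> k \<and>
         nonneg_submodular X f \<and>
         offline_approx X Ms f \<gamma>_off off \<and> \<gamma>_off \<le> K * real p \<and>
         OPT \<in> feasible_sets X Ms \<and> (\<forall>T\<in>feasible_sets X Ms. f T \<le> f OPT) \<and>
         0 < \<epsilon> \<and> \<epsilon> \<le> real p \<and>
         (\<forall>i. distinct (\<sigma> i) \<and> set (\<sigma> i) = X) \<longrightarrow>
         (\<forall>(S, w) \<in> set_pmf (streaming_algorithm f Ms off p k \<epsilon> (d p \<epsilon>) \<sigma>).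
            S \<in> feasible_sets X Ms \<and>
            real w \<le> C_mem * (real p ^ 3 * real k * log 2 (real k) / \<epsilon> ^ 3)) \<and>
         f OPT \<le> (real p + 1 + \<gamma>_off + C * \<epsilon>) *
           measure_pmf.expectation (streaming_algorithm f Ms off p k \<epsilon> (d p \<epsilon>) \<sigma>) (\<lambda>(S, w). f S))"
proof (rule exI[of _ pass_count], rule exI[of _ 9], rule exI[of _ 72], intro conjI allI impI)
  fix p :: nat and \<epsilon> :: real
  assume "1 \<le> p \<and> 0 < \<epsilon> \<and> \<epsilon> \<le> real p"
  then have "1 \<le> p" "0 < \<epsilon>" "\<epsilon> \<le> real p" by auto
  note B = pass_count_bounds[OF this]
  show "1 \<le> pass_count p \<epsilon>" using B(3) by simp
  show "real (pass_count p \<epsilon> + 1) \<le> 9 * (real p / \<epsilon>)"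
    using B(2,4) unfolding of_nat_add of_nat_1 by linarith
next
  fix K :: real
  show "\<exists>C :: real. \<forall>(X :: 'a set) Ms p k f \<gamma>_off off OPT \<epsilon> \<sigma>.
         1 \<le> p \<and> p_matchoid p X Ms \<and> k = matchoid_rank X Ms \<and> 2 \<le> k \<and>
         nonneg_submodular X f \<and>
         offline_approx X Ms f \<gamma>_off off \<and> \<gamma>_off \<le> K * real p \<and>
         OPT \<in> feasible_sets X Ms \<and> (\<forall>T\<in>feasible_sets X Ms. f T \<le> f OPT) \<and>
         0 < \<epsilon> \<and> \<epsilon> \<le> real p \<and>
         (\<forall>i. distinct (\<sigma> i) \<and> set (\<sigma> i) = X) \<longrightarrow>
         (\<forall>(S, w) \<in> set_pmf (streaming_algorithm f Ms off p k \<epsilon> (pass_count p \<epsilon>) \<sigma>).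
            S \<in> feasible_sets X Ms \<and>
            real w \<le> 72 * (real p ^ 3 * real k * log 2 (real k) / \<epsilon> ^ 3)) \<and>
         f OPT \<le> (real p + 1 + \<gamma>_off + C * \<epsilon>) *
           measure_pmf.expectation (streaming_algorithm f Ms off p k \<epsilon> (pass_count p \<epsilon>) \<sigma>) (\<lambda>(S, w). f S)"
  proof (intro exI[of _ "36 + 14 * \<bar>K\<bar>"] allI impI, elim conjE, goal_cases)
    case (1 X Ms p k f \<gamma> off OPT \<epsilon> \<sigma>)
    have max: "f T \<le> f OPT" if "T \<in> feasible_sets X Ms" for T using 1(9) that by blast
    have str: "set (\<sigma> i) = X" for i using 1(12) by blast
    have "f OPT \<le> (real p + 1 + \<gamma> + (36 + 14 * \<bar>K\<bar>) * \<epsilon>) *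
        measure_pmf.expectation (streaming_algorithm f Ms off p k \<epsilon> (pass_count p \<epsilon>) \<sigma>) (\<lambda>(S, w). f S)"
      by (rule streaming_guarantee(2)[OF 1(1-8) max 1(10,11) str])
    moreover have "S \<in> feasible_sets X Ms \<and> real w \<le> 72 * (real p ^ 3 * real k * log 2 (real k) / \<epsilon> ^ 3)"
      if "(S, w) \<in> set_pmf (streaming_algorithm f Ms off p k \<epsilon> (pass_count p \<epsilon>) \<sigma>)" for S w
      by (rule streaming_guarantee(1)[OF 1(1-8) max 1(10,11) str that])
    ultimately show ?case by blast
  qed
qed

end
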